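(* Let $\mathcal{A}$ be an $n\times n$ sign pattern. Then $\mathcal{A}$ allows the non-symmetric strong multiplicity property (nSMP) if and only if $\mathcal{A}$ allows distinct eigenvalues.
   Context: A real $n\times n$ matrix $A$ has the non-symmetric strong multiplicity property (nSMP) if the only real $n\times n$ matrix $X$ satisfying all of (1) $A\circ X=O$ (entrywise product), (2) $AX^T-X^TA=O$, and (3) $\mathrm{tr}(X^TA^k)=0$ for all $0\le k<n$, is $X=O$ (the zero matrix). A sign pattern is an $n\times n$ matrix $\mathcal{A}$ with entries in $\{+,-,0\}$; $Q(\mathcal{A})$ is the set of real $n\times n$ matrices $A$ with $A_{ij}>0$ if $\mathcal{A}_{ij}=+$, $A_{ij}<0$ if $\mathcal{A}_{ij}=-$, and $A_{ij}=0$ if $\mathcal{A}_{ij}=0$. The pattern $\mathcal{A}$ allows a property if some $A\in Q(\mathcal{A})$ has the property. A real $n\times n$ matrix has distinct eigenvalues if it has $n$ distinct (complex) eigenvalues. *)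

theory Defs
  imports Jordan_Normal_Form.Spectral_Radius
begin

definition hadamard_mat :: "'a :: times mat \<Rightarrow> 'a mat \<Rightarrow> 'a mat" where
  "hadamard_mat A B = mat (dim_row A) (dim_col A) (\<lambda>(i, j). A $$ (i, j) * B $$ (i, j))"

definition trace_mat :: "'a :: comm_monoid_add mat \<Rightarrow> 'a" where
  "trace_mat A = (\<Sum>i<dim_row A. A $$ (i, i))"

definition nSMP :: "nat \<Rightarrow> real mat \<Rightarrow> bool" where
  "nSMP n A \<longleftrightarrow>
     A \<in> carrier_mat n n \<and>
     (\<forall>X \<in> carrier_mat n n.
        hadamard_mat A X = 0\<^sub>m n n \<longrightarrow>
        A * transpose_mat X - transpose_mat X * A = 0\<^sub>m n n \<longrightarrow>
        (\<forall>k<n. trace_mat (transpose_mat X * A ^\<^sub>m k) = 0) \<longrightarrow>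
        X = 0\<^sub>m n n)"

definition distinct_eigenvalues :: "nat \<Rightarrow> real mat \<Rightarrow> bool" where
  "distinct_eigenvalues n A \<longleftrightarrow>
     A \<in> carrier_mat n n \<and> card (spectrum (map_mat complex_of_real A)) = n"

datatype pattern_entry = PosEntry | NegEntry | ZeroEntry

fun has_sign :: "real \<Rightarrow> pattern_entry \<Rightarrow> bool" where
  "has_sign x PosEntry \<longleftrightarrow> x > 0"
| "has_sign x NegEntry \<longleftrightarrow> x < 0"
| "has_sign x ZeroEntry \<longleftrightarrow> x = 0"

definition qualitative_class :: "pattern_entry mat \<Rightarrow> real mat set" where
  "qualitative_class P =
     {A \<in> carrier_mat (dim_row P) (dim_col P).
        \<forall>i<dim_row P. \<forall>j<dim_col P. has_sign (A $$ (i, j)) (P $$ (i, j))}"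

definition pattern_allows :: "pattern_entry mat \<Rightarrow> (real mat \<Rightarrow> bool) \<Rightarrow> bool" where
  "pattern_allows P prop \<longleftrightarrow> (\<exists>A \<in> qualitative_class P. prop A)"

end

(* If A has distinct eigenvalues, then a matrix X^T commuting with A is diagonal in an eigenbasis
   of A, and tr(X^T A^k) = 0 for k < n is a Vandermonde system forcing this diagonal to vanish.

   Conversely, the nSMP says that every real matrix has the form [A,G] + B + p(A) with B supported
   on the support of A.  Let M = (1-t)A + tD with D = diag(0,...,n-1).  By this spanning property
   one can solve (A+B)G = G p(M) modulo any power of t, where the entries of B, G and the
   coefficients of p are polynomials in t, and B = 0, G = I, p(M) = A at t = 0.  Let disc(X) be
   the determinant of (tr X^(i+j)) for i, j < n.  Conjugation by G preserves it modulo t^m, and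
   disc(p(M)) = d^2 disc(M) with d = 1 at t = 0.  Since disc(M) is nonzero at t = 1, it is a
   nonzero polynomial, hence so is disc(A+B).  For small t > 0 the matrix A+B then has distinct
   eigenvalues and still has the signs of A. *)
theory Submission
  imports Defs
begin

text \<open>The conditions on X in the nSMP say that X is Frobenius-orthogonal to the matrices
  supported where A is nonzero, to the commutators [A,G] and to the powers of A; the spanning
  property is the dual statement. The obstacle is that A may have repeated eigenvalues while B must
  not leave the support of A. The path M may run through arbitrary matrices, and A+B imitates it
  only up to similarity and up to a polynomial p; the freedom in p absorbs the changes that
  commutators and supported matrices cannot produce. The discriminant is written with traces because
  this makes sense over any commutative ring: it can be formed over the polynomials in t and
  commutes with evaluation. A lift to all orders would be a power series in t, with a convergence
  question when t becomes a small real number. Polynomials avoid it, and finite precision is enough: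
  if e is the degree of disc(M), then t^(e+1) cannot divide d^2 disc(M), because d is 1 at t = 0.
  This fixes the order at which the lifting stops.\<close>

section \<open>Traces of matrices over commutative rings\<close>

lemma pow_mat_add:
  assumes "(A :: 'a :: semiring_1 mat) \<in> carrier_mat n n"
  shows "A ^\<^sub>m (i + j) = A ^\<^sub>m i * A ^\<^sub>m j"
proof (induction j)
  case (Suc j)
  then show ?case using assms by (simp add: assoc_mult_mat[of _ n n _ n _ n])
qed (use assms in simp)

lemma trace_mat_add:
  assumes "A \<in> carrier_mat n n" "B \<in> carrier_mat n n"
  shows "trace_mat (A + B) = trace_mat A + trace_mat B"
  using assms by (simp add: trace_mat_def sum.distrib)

lemma trace_mat_smult:
  assumes "(A :: 'a :: comm_ring_1 mat) \<in> carrier_mat n n"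
  shows "trace_mat (c \<cdot>\<^sub>m A) = c * trace_mat A"
  using assms by (simp add: trace_mat_def sum_distrib_left)

lemma trace_mat_zero [simp]: "trace_mat (0\<^sub>m n n) = 0"
  by (simp add: trace_mat_def)

lemma trace_mat_comm:
  assumes "(A :: 'a :: comm_ring_1 mat) \<in> carrier_mat n m" "B \<in> carrier_mat m n"
  shows "trace_mat (A * B) = trace_mat (B * A)"
proof -
  have "trace_mat (A * B) = (\<Sum>i<n. \<Sum>j<m. A $$ (i, j) * B $$ (j, i))"
    using assms by (auto simp: trace_mat_def scalar_prod_def atLeast0LessThan intro!: sum.cong)
  also have "\<dots> = (\<Sum>j<m. \<Sum>i<n. B $$ (j, i) * A $$ (i, j))"
    by (subst sum.swap) (simp add: mult.commute)
  also have "\<dots> = trace_mat (B * A)"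
    using assms by (auto simp: trace_mat_def scalar_prod_def atLeast0LessThan intro!: sum.cong)
  finally show ?thesis .
qed

lemma trace_mat_hom:
  assumes "comm_ring_hom h" "A \<in> carrier_mat n n"
  shows "trace_mat (map_mat h A) = h (trace_mat A)"
proof -
  interpret comm_ring_hom h by fact
  show ?thesis using assms(2) by (simp add: trace_mat_def hom_sum)
qed

lemma trace_mat_similar:
  assumes "similar_mat_wit (A :: 'a :: comm_ring_1 mat) B P Q"
  shows "trace_mat A = trace_mat B"
proof -
  note w = similar_mat_witD[OF refl assms]
  have "trace_mat A = trace_mat (P * (B * Q))"
    by (subst w(3), subst assoc_mult_mat[OF w(6,5,7)]) (rule refl)
  also have "\<dots> = trace_mat (B * Q * P)"
    by (rule trace_mat_comm[OF w(6) mult_carrier_mat[OF w(5,7)]])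
  also have "B * Q * P = B"
    unfolding assoc_mult_mat[OF w(5,7,6)] w(2) by (rule right_mult_one_mat[OF w(5)])
  finally show ?thesis .
qed

section \<open>The commutative algebra generated by one matrix\<close>

text \<open>A polynomial of degree below \<open>k\<close> evaluated at \<open>M\<close>. Its
  coefficients form a plain function, since over the ring of polynomials in t they are themselves
  polynomials.\<close>

primrec pow_comb :: "'a :: comm_ring_1 mat \<Rightarrow> (nat \<Rightarrow> 'a) \<Rightarrow> nat \<Rightarrow> 'a mat" where
  "pow_comb M c 0 = 0\<^sub>m (dim_row M) (dim_row M)"
| "pow_comb M c (Suc k) = pow_comb M c k + c k \<cdot>\<^sub>m (M ^\<^sub>m k)"

text \<open>This is the algebra of all polynomials in \<open>M\<close>; cutting at the dimension
  loses nothing, by Cayley-Hamilton, and gives each member a coefficient vector of length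
  \<open>n\<close>, as needed for determinants.\<close>

definition pow_span :: "'a :: comm_ring_1 mat \<Rightarrow> 'a mat set" where
  "pow_span M = range (\<lambda>c. pow_comb M c (dim_row M))"

text \<open>If \<open>X\<close> is triangularizable with diagonal \<open>l\<close>, this is \<open>V V\<^sup>T\<close> for the Vandermonde matrix
  \<open>V\<close> of \<open>l\<close>, so its determinant is the discriminant of the characteristic polynomial.\<close>
definition trace_form :: "nat \<Rightarrow> 'a :: comm_ring_1 mat \<Rightarrow> 'a mat" where
  "trace_form n X = mat n n (\<lambda>(i, j). trace_mat (X ^\<^sub>m (i + j)))"

lemma trace_form_carrier [simp]: "trace_form n X \<in> carrier_mat n n"
  "dim_row (trace_form n X) = n" "dim_col (trace_form n X) = n"
  by (simp_all add: trace_form_def)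

lemma trace_form_hom:
  assumes "comm_ring_hom h" "X \<in> carrier_mat n n"
  shows "map_mat h (trace_form n X) = trace_form n (map_mat h X)"
proof -
  interpret comm_ring_hom h by fact
  show ?thesis
    by (rule eq_matI)
      (use assms in \<open>auto simp: trace_form_def mat_hom_pow[symmetric] trace_mat_hom[OF assms(1) pow_carrier_mat]\<close>)
qed

context
  fixes M :: "'a :: comm_ring_1 mat" and n :: nat
  assumes M: "M \<in> carrier_mat n n"
begin

lemma square_pow_mat_dims [simp]: "dim_row M = n" "dim_col M = n"
  "dim_row (M ^\<^sub>m k) = n" "dim_col (M ^\<^sub>m k) = n"
  using M pow_carrier_mat[OF M, of k] by auto

lemma pow_comb_carrier [simp]:
  "pow_comb M c k \<in> carrier_mat n n" "dim_row (pow_comb M c k) = n" "dim_col (pow_comb M c k) = n"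
proof -
  show "pow_comb M c k \<in> carrier_mat n n" using M by (induction k) auto
  then show "dim_row (pow_comb M c k) = n" "dim_col (pow_comb M c k) = n" by auto
qed

lemma pow_comb_add:
  "pow_comb M (\<lambda>j. c j + d j) k = pow_comb M c k + pow_comb M d k"
proof (induction k)
  case (Suc k)
  show ?case unfolding pow_comb.simps Suc
    by (rule eq_matI) (auto simp: algebra_simps simp del: pow_mat_dim)
qed (use M in simp)

lemma pow_comb_smult:
  "pow_comb M (\<lambda>j. s * c j) k = s \<cdot>\<^sub>m pow_comb M c k"
proof (induction k)
  case (Suc k)
  show ?case unfolding pow_comb.simps Suc
    by (rule eq_matI) (auto simp: algebra_simps simp del: pow_mat_dim)
qed (use M in simp)

lemma pow_comb_zero [simp]: "pow_comb M (\<lambda>j. 0) k = 0\<^sub>m n n"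
proof (induction k)
  case (Suc k)
  show ?case unfolding pow_comb.simps Suc
    by (rule eq_matI) (auto simp del: pow_mat_dim)
qed simp

lemma pow_comb_unit:
  "pow_comb M (\<lambda>j. if j = i then 1 else 0) k = (if i < k then M ^\<^sub>m i else 0\<^sub>m n n)"
proof (induction k)
  case (Suc k)
  show ?case unfolding pow_comb.simps Suc
    by (rule eq_matI) (auto simp: less_Suc_eq simp del: pow_mat_dim)
qed (use M in simp)

text \<open>\<open>case_nat 0 c\<close> is the coefficient sequence of x p(x): a shift by one with
  constant term 0, hence one more summand.\<close>

lemma pow_comb_mult_right:
  "pow_comb M c k * M = pow_comb M (case_nat 0 c) (Suc k)"
proof (induction k)
  case (Suc k)
  have "pow_comb M c (Suc k) * M = pow_comb M c k * M + c k \<cdot>\<^sub>m (M ^\<^sub>m Suc k)"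
    using M by (simp add: add_mult_distrib_mat[of _ n n _ _ n] mult_smult_assoc_mat[of _ n n _ n])
  then show ?case unfolding Suc by simp
next
  case 0
  show ?case using M by (intro eq_matI) auto
qed

lemma trace_pow_comb_mult:
  assumes X: "X \<in> carrier_mat n n"
  shows "trace_mat (pow_comb M c k * X) = (\<Sum>j<k. c j * trace_mat (M ^\<^sub>m j * X))"
proof (induction k)
  case (Suc k)
  have "pow_comb M c (Suc k) * X = pow_comb M c k * X + c k \<cdot>\<^sub>m (M ^\<^sub>m k * X)"
    using M X by (simp add: add_mult_distrib_mat[of _ n n _ _ n] mult_smult_assoc_mat[of _ n n _ n])
  then show ?case
    using M X Suc by (simp add: trace_mat_add[of _ n] trace_mat_smult[of _ n] mult_carrier_mat[of _ n n])
qed (use M X in simp)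

lemma Cayley_Hamilton:
  "\<exists>K. pow_comb M (coeff (char_poly M)) (Suc (n + K)) = 0\<^sub>m n n"
proof -
  \<comment> \<open>comparing coefficients in \<open>N * (x - M) = \<chi>\<close> gives a telescoping sum for \<open>\<chi>(M)\<close>\<close>
  define N where "N = adj_mat (char_poly_matrix M)"
  define Q where "Q j = map_mat (\<lambda>p. coeff p j) N" for j
  define \<chi> where "\<chi> = char_poly M"
  have C: "char_poly_matrix M \<in> carrier_mat n n" using M by simp
  have N: "N \<in> carrier_mat n n" and NC: "N * char_poly_matrix M = \<chi> \<cdot>\<^sub>m 1\<^sub>m n"
    using adj_mat[OF C] unfolding N_def \<chi>_def char_poly_def by auto
  have Q: "Q j \<in> carrier_mat n n" for j using N by (simp add: Q_def)
  \<comment> \<open>The coefficient of x^j in N (x - M) is Q_(j-1) - Q_j M, with Q_(-1) = 0.\<close>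
  have step: "\<chi>_j \<cdot>\<^sub>m 1\<^sub>m n + Q j * M = (if j = 0 then 0\<^sub>m n n else Q (j - 1))"
    if "\<chi>_j = coeff \<chi> j" for j \<chi>_j
  proof (rule eq_matI)
    fix a b assume ab: "a < dim_row (if j = 0 then 0\<^sub>m n n else Q (j - 1))"
      "b < dim_col (if j = 0 then 0\<^sub>m n n else Q (j - 1))"
    then have ab: "a < n" "b < n" using Q[of "j - 1"] by (auto split: if_splits)
    have "(\<chi> \<cdot>\<^sub>m 1\<^sub>m n) $$ (a, b) = (\<Sum>k<n. N $$ (a, k) * char_poly_matrix M $$ (k, b))"
      unfolding NC[symmetric] using N C ab
      by (auto simp: scalar_prod_def atLeast0LessThan intro!: sum.cong)
    also have "\<dots> = (\<Sum>k<n. (if k = b then pCons 0 (N $$ (a, k)) else 0) - Polynomial.smult (M $$ (k, b)) (N $$ (a, k)))"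
      by (rule sum.cong) (use M ab in \<open>auto simp: char_poly_matrix_def\<close>)
    also have "\<dots> = pCons 0 (N $$ (a, b)) - (\<Sum>k<n. Polynomial.smult (M $$ (k, b)) (N $$ (a, k)))"
      using ab by (simp add: sum_subtractf)
    finally have "coeff ((\<chi> \<cdot>\<^sub>m 1\<^sub>m n) $$ (a, b)) j
      = coeff (pCons 0 (N $$ (a, b))) j - (\<Sum>k<n. M $$ (k, b) * coeff (N $$ (a, k)) j)"
      by (simp add: coeff_sum)
    moreover have "(Q j * M) $$ (a, b) = (\<Sum>k<n. M $$ (k, b) * coeff (N $$ (a, k)) j)"
      using M N ab Q[of j] by (auto simp: Q_def scalar_prod_def atLeast0LessThan mult.commute intro!: sum.cong)
    ultimately show "(\<chi>_j \<cdot>\<^sub>m 1\<^sub>m n + Q j * M) $$ (a, b) = (if j = 0 then 0\<^sub>m n n else Q (j - 1)) $$ (a, b)"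
      using ab M N Q[of j] that by (auto simp: Q_def coeff_pCons split: nat.splits)
  qed (use Q[of "j - 1"] Q[of j] M in auto)
  \<comment> \<open>Multiplying the relation for j by M^j on the right and summing up to k,
    neighbouring terms cancel and only the last product stays.\<close>
  have tel: "pow_comb M (coeff \<chi>) (Suc k) + Q k * M ^\<^sub>m Suc k = 0\<^sub>m n n" for k
  proof (induction k)
    case 0
    have "pow_comb M (coeff \<chi>) (Suc 0) + Q 0 * M ^\<^sub>m Suc 0 = coeff \<chi> 0 \<cdot>\<^sub>m 1\<^sub>m n + Q 0 * M"
      using M Q[of 0] by (simp add: left_mult_one_mat[of _ n n] left_add_zero_mat[of _ n n])
    then show ?case using step[OF refl, of 0] by simp
  next
    case (Suc k)
    let ?P = "M ^\<^sub>m Suc k"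
    have P: "?P \<in> carrier_mat n n" using M by (rule pow_carrier_mat)
    have PM: "M ^\<^sub>m Suc (Suc k) = M * ?P"
      using pow_mat_add[OF M, of 1 "Suc k"] M by (simp add: left_mult_one_mat[of _ n n])
    have "Q k * ?P = (coeff \<chi> (Suc k) \<cdot>\<^sub>m 1\<^sub>m n + Q (Suc k) * M) * ?P"
      using step[OF refl, of "Suc k"] by simp
    also have "\<dots> = coeff \<chi> (Suc k) \<cdot>\<^sub>m ?P + Q (Suc k) * (M * ?P)"
      using P Q[of "Suc k"] M
      by (simp del: pow_mat.simps add: add_mult_distrib_mat[of _ n n _ _ n] mult_carrier_mat[of _ n n]
          mult_smult_assoc_mat[of _ n n _ n] assoc_mult_mat[of _ n n _ n _ n] left_mult_one_mat[of _ n n])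
    finally have q: "Q k * ?P = coeff \<chi> (Suc k) \<cdot>\<^sub>m ?P + Q (Suc k) * (M * ?P)" .
    have car: "coeff \<chi> (Suc k) \<cdot>\<^sub>m ?P \<in> carrier_mat n n" "Q (Suc k) * (M * ?P) \<in> carrier_mat n n"
      using P mult_carrier_mat[OF Q mult_carrier_mat[OF M P]] by simp_all
    have "pow_comb M (coeff \<chi>) (Suc (Suc k)) + Q (Suc k) * M ^\<^sub>m Suc (Suc k)
      = pow_comb M (coeff \<chi>) (Suc k) + coeff \<chi> (Suc k) \<cdot>\<^sub>m ?P + Q (Suc k) * (M * ?P)"
      unfolding PM by simp
    also have "\<dots> = pow_comb M (coeff \<chi>) (Suc k) + Q k * ?P"
      unfolding q by (rule assoc_add_mat[OF pow_comb_carrier(1) car])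
    finally show ?case using Suc by simp
  qed
  \<comment> \<open>Any bound on the degrees in the adjugate makes the leftover
    \<open>Q (n + K)\<close> vanish. Adding \<open>n\<close> keeps all coefficients of the
    characteristic polynomial inside the sum.\<close>
  obtain K where K: "\<And>a b. a < n \<Longrightarrow> b < n \<Longrightarrow> degree (N $$ (a, b)) < K"
  proof
    fix a b assume "a < n" "b < n"
    then have "degree (N $$ (a, b)) \<le> Max ((\<lambda>(a, b). degree (N $$ (a, b))) ` ({..<n} \<times> {..<n}))"
      by (intro Max_ge) auto
    then show "degree (N $$ (a, b)) < Suc (Max ((\<lambda>(a, b). degree (N $$ (a, b))) ` ({..<n} \<times> {..<n})))"
      by simp
  qed
  have "Q (n + K) = 0\<^sub>m n n"
    by (rule eq_matI) (use N K in \<open>force simp: Q_def intro!: coeff_eq_0\<close>)+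
  then have "pow_comb M (coeff \<chi>) (Suc (n + K)) + 0\<^sub>m n n = 0\<^sub>m n n"
    using tel[of "n + K"] M by (simp del: pow_comb.simps pow_mat.simps)
  then show ?thesis unfolding \<chi>_def using M
    by (intro exI[of _ K]) (metis pow_comb_carrier(1) right_add_zero_mat)
qed

text \<open>The characteristic polynomial is monic of degree \<open>n\<close>: terms beyond
  \<open>n\<close> drop out of \<open>Cayley_Hamilton\<close>, and the relation can be solved for
  the top power without division.\<close>

lemma pow_mat_dim_in_pow_span: "M ^\<^sub>m n \<in> pow_span M"
proof -
  define \<chi> where "\<chi> = char_poly M"
  have deg: "degree \<chi> = n" and monic: "coeff \<chi> n = 1"
    using degree_monic_char_poly[OF M] by (auto simp: \<chi>_def)
  have tail: "pow_comb M (coeff \<chi>) (Suc (n + K)) = pow_comb M (coeff \<chi>) (Suc n)" for K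
  proof (induction K)
    case (Suc K)
    have "coeff \<chi> (Suc (n + K)) = 0" by (rule coeff_eq_0) (use deg in simp)
    then have "pow_comb M (coeff \<chi>) (Suc (n + Suc K)) = pow_comb M (coeff \<chi>) (Suc (n + K)) + 0\<^sub>m n n"
      by (subst pow_comb.simps, intro eq_matI) (use M in \<open>auto simp del: pow_comb.simps\<close>)
    then show ?case using Suc by (metis pow_comb_carrier(1) right_add_zero_mat)
  qed simp
  from Cayley_Hamilton have "pow_comb M (coeff \<chi>) (Suc n) = 0\<^sub>m n n"
    unfolding \<chi>_def[symmetric] tail by blast
  moreover have "1 \<cdot>\<^sub>m M ^\<^sub>m n = M ^\<^sub>m n" by (rule eq_matI) (auto simp del: pow_mat_dim)
  ultimately have "pow_comb M (coeff \<chi>) n + M ^\<^sub>m n = 0\<^sub>m n n"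
    using monic by simp
  then have "(pow_comb M (coeff \<chi>) n + M ^\<^sub>m n) $$ (i, j) = 0" if "i < n" "j < n" for i j
    using that by simp
  then have "(M ^\<^sub>m n) $$ (i, j) = - (pow_comb M (coeff \<chi>) n $$ (i, j))" if "i < n" "j < n" for i j
    using that M by (simp add: eq_neg_iff_add_eq_0 add.commute)
  then have "M ^\<^sub>m n = (-1) \<cdot>\<^sub>m pow_comb M (coeff \<chi>) n"
    by (intro eq_matI) (use M in auto)
  then have "M ^\<^sub>m n = pow_comb M (\<lambda>j. (-1) * coeff \<chi> j) n"
    by (simp only: pow_comb_smult)
  then show ?thesis unfolding pow_span_def using M by auto
qed

lemma pow_span_carrier: "U \<in> pow_span M \<Longrightarrow> U \<in> carrier_mat n n"
  using M by (auto simp: pow_span_def)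

lemma pow_span_add: "U \<in> pow_span M \<Longrightarrow> W \<in> pow_span M \<Longrightarrow> U + W \<in> pow_span M"
  by (auto simp: pow_span_def pow_comb_add[symmetric])

lemma pow_span_smult: "U \<in> pow_span M \<Longrightarrow> s \<cdot>\<^sub>m U \<in> pow_span M"
  by (auto simp: pow_span_def pow_comb_smult[symmetric])

lemma pow_span_mult_right:
  assumes "U \<in> pow_span M"
  shows "U * M \<in> pow_span M"
proof -
  obtain c where U: "U = pow_comb M c n" using assms M by (auto simp: pow_span_def)
  have "U * M = pow_comb M (case_nat 0 c) n + case_nat 0 c n \<cdot>\<^sub>m M ^\<^sub>m n"
    unfolding U pow_comb_mult_right by simp
  then show ?thesis
    using pow_span_add pow_span_smult[OF pow_mat_dim_in_pow_span] M by (auto simp: pow_span_def)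
qed

lemma pow_span_zero: "0\<^sub>m n n \<in> pow_span M"
proof -
  have "0\<^sub>m n n = 0 \<cdot>\<^sub>m M ^\<^sub>m n" using M by (intro eq_matI) auto
  then show ?thesis using pow_span_smult[OF pow_mat_dim_in_pow_span] by metis
qed

lemma pow_span_mult_pow: "U \<in> pow_span M \<Longrightarrow> U * M ^\<^sub>m k \<in> pow_span M"
proof (induction k)
  case (Suc k)
  have "U * M ^\<^sub>m Suc k = U * M ^\<^sub>m k * M"
    using M pow_span_carrier[OF Suc(2)] by (simp add: assoc_mult_mat[of _ n n _ n _ n])
  then show ?case using pow_span_mult_right Suc by metis
qed (use M in \<open>auto simp: right_mult_one_mat[OF pow_span_carrier]\<close>)

lemma one_in_pow_span: "1\<^sub>m n \<in> pow_span M"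
\<comment> \<open>For \<open>n = 0\<close> the combination has no summand, not even for the zeroth
  power; there the identity coincides with \<open>M ^\<^sub>m n\<close>.\<close>
proof (cases "n = 0")
  case True
  then have "1\<^sub>m n = M ^\<^sub>m n" using M by simp
  then show ?thesis using pow_mat_dim_in_pow_span by metis
next
  case False
  then have "1\<^sub>m n = pow_comb M (\<lambda>j. if j = 0 then 1 else 0) n"
    using M by (subst pow_comb_unit) auto
  then show ?thesis using M unfolding pow_span_def by auto
qed

lemma pow_mat_in_pow_span: "M ^\<^sub>m k \<in> pow_span M"
  using pow_span_mult_pow[OF one_in_pow_span, of k] M by (simp add: left_mult_one_mat[of _ n n])

lemma pow_span_mult:
  assumes U: "U \<in> pow_span M" and W: "W \<in> pow_span M"
  shows "U * W \<in> pow_span M"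
proof -
  have "U * pow_comb M c k \<in> pow_span M" for c k
  proof (induction k)
    case 0
    then show ?case using M pow_span_zero pow_span_carrier[OF U] by simp
  next
    case (Suc k)
    have "U * pow_comb M c (Suc k) = U * pow_comb M c k + c k \<cdot>\<^sub>m (U * M ^\<^sub>m k)"
      using M pow_span_carrier[OF U] by (simp add: mult_add_distrib_mat[of _ n n _ n] mult_smult_distrib[of _ n n _ n])
    then show ?case using Suc pow_span_add pow_span_smult pow_span_mult_pow[OF U] by metis
  qed
  then show ?thesis using W by (auto simp: pow_span_def)
qed

end

section \<open>Perturbation of the trace form\<close>

lemma comm_ring_hom_eval_poly: "comm_ring_hom (\<lambda>p :: 'a :: comm_ring_1 poly. poly p x)"
  by unfold_locales auto

lemma pow_comb_hom:
  assumes "comm_ring_hom h" and M: "M \<in> carrier_mat n n"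
  shows "map_mat h (pow_comb M c k) = pow_comb (map_mat h M) (\<lambda>j. h (c j)) k"
proof -
  interpret comm_ring_hom h by fact
  have [simp]: "map_mat h M \<in> carrier_mat n n" using M by simp
  show ?thesis
  proof (induction k)
    case (Suc k)
    have "map_mat h (pow_comb M c (Suc k)) = map_mat h (pow_comb M c k) + h (c k) \<cdot>\<^sub>m map_mat h (M ^\<^sub>m k)"
      by (rule eq_matI) (use M in \<open>auto simp: hom_distribs square_pow_mat_dims[OF M] simp del: pow_mat_dim\<close>)
    then show ?case unfolding Suc using M by (simp add: mat_hom_pow)
  qed (use M in auto)
qed

text \<open>\<open>trace_form\<close> is the Gram matrix of the form (U, W) -> tr(UW) on the first
  \<open>n\<close> powers. Expressing the powers of \<open>Q\<close> through those of
  \<open>M\<close> changes it by a congruence.\<close>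

lemma trace_form_basis_change:
  fixes M Q :: "'a :: comm_ring_1 mat"
  assumes M: "M \<in> carrier_mat n n" and Q: "Q \<in> carrier_mat n n"
    and C: "\<And>i. i < n \<Longrightarrow> Q ^\<^sub>m i = pow_comb M (C i) n"
  shows "det (trace_form n Q) = (det (mat n n (\<lambda>(i, j). C i j)))\<^sup>2 * det (trace_form n M)"
proof -
  let ?C = "mat n n (\<lambda>(i, j). C i j)"
  have "trace_form n Q = ?C * trace_form n M * transpose_mat ?C"
  proof (rule eq_matI)
    fix i k assume "i < dim_row (?C * trace_form n M * transpose_mat ?C)"
      "k < dim_col (?C * trace_form n M * transpose_mat ?C)"
    then have ik: "i < n" "k < n" by auto
    have pM: "M ^\<^sub>m j \<in> carrier_mat n n" for j using M by simp
    have "trace_form n Q $$ (i, k) = trace_mat (pow_comb M (C i) n * pow_comb M (C k) n)"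
      using ik by (simp add: trace_form_def pow_mat_add[OF Q] C)
    also have "\<dots> = (\<Sum>j<n. C i j * trace_mat (pow_comb M (C k) n * M ^\<^sub>m j))"
      by (simp add: trace_pow_comb_mult[OF M pow_comb_carrier(1)[OF M]]
          trace_mat_comm[OF pM pow_comb_carrier(1)[OF M]])
    also have "\<dots> = (\<Sum>j<n. \<Sum>l<n. C i j * (C k l * trace_mat (M ^\<^sub>m (j + l))))"
      by (simp add: trace_pow_comb_mult[OF M pM] sum_distrib_left pow_mat_add[OF M, symmetric] add.commute)
    also have "\<dots> = (\<Sum>l<n. (\<Sum>j<n. C i j * trace_mat (M ^\<^sub>m (j + l))) * C k l)"
      by (subst sum.swap) (simp add: sum_distrib_left sum_distrib_right mult_ac)
    also have "\<dots> = (?C * trace_form n M * transpose_mat ?C) $$ (i, k)"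
      using ik by (auto simp: scalar_prod_def trace_form_def atLeast0LessThan intro!: sum.cong)
    finally show "trace_form n Q $$ (i, k) = (?C * trace_form n M * transpose_mat ?C) $$ (i, k)" .
  qed auto
  then show ?thesis
    by (simp add: det_mult[of _ n] det_transpose[of _ n] mult_carrier_mat[of _ n n] power2_eq_square mult_ac)
qed

text \<open>Everything produced by multiplying out stays in the algebra generated by
  \<open>M\<close>, and every term other than the pure power of \<open>M\<close> carries a factor
  \<open>t\<close>.\<close>

lemma pow_mat_perturb_in_pow_span:
  fixes M :: "'a :: comm_ring_1 mat"
  assumes M: "M \<in> carrier_mat n n" and U: "U \<in> pow_span M"
  shows "\<exists>W \<in> pow_span M. (M + t \<cdot>\<^sub>m U) ^\<^sub>m i = M ^\<^sub>m i + t \<cdot>\<^sub>m W"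
proof (induction i)
  case 0
  show ?case
    by (rule bexI[OF _ pow_span_zero[OF M]]) (use M pow_span_carrier[OF M U] in auto)
next
  case (Suc i)
  then obtain W where W: "W \<in> pow_span M" and eq: "(M + t \<cdot>\<^sub>m U) ^\<^sub>m i = M ^\<^sub>m i + t \<cdot>\<^sub>m W" by blast
  let ?V = "M ^\<^sub>m i * U + (W * M + t \<cdot>\<^sub>m (W * U))"
  have V: "?V \<in> pow_span M"
    by (intro pow_span_add[OF M] pow_span_smult[OF M] pow_span_mult[OF M] pow_span_mult_right[OF M]
        pow_mat_in_pow_span[OF M] U W)
  note car = M pow_carrier_mat[OF M, of i] pow_span_carrier[OF M U] pow_span_carrier[OF M W]
  have "(M + t \<cdot>\<^sub>m U) ^\<^sub>m Suc i = (M ^\<^sub>m i + t \<cdot>\<^sub>m W) * (M + t \<cdot>\<^sub>m U)"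
    by (simp add: eq)
  also have "\<dots> = (M ^\<^sub>m i * M + t \<cdot>\<^sub>m (W * M)) + t \<cdot>\<^sub>m (M ^\<^sub>m i * U + t \<cdot>\<^sub>m (W * U))"
    using car by (simp add: add_mult_distrib_mat[of _ n n _ _ n] mult_add_distrib_mat[of _ n n _ n]
        mult_smult_assoc_mat[of _ n n _ n] mult_smult_distrib[of _ n n _ n])
  also have "\<dots> = M ^\<^sub>m Suc i + t \<cdot>\<^sub>m ?V"
    by (rule eq_matI) (use car in \<open>simp_all add: algebra_simps\<close>)
  finally show ?case using V by blast
qed

text \<open>The matrix expressing the powers of M + tU in those of M is the identity modulo t; its
  determinant is \<open>d\<close>.\<close>

lemma det_trace_form_perturb:
  fixes M :: "'a :: comm_ring_1 poly mat"
  assumes M: "M \<in> carrier_mat n n" and U: "U \<in> pow_span M"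
  shows "\<exists>d. poly d 0 = 1 \<and>
    det (trace_form n (M + [:0, 1:] \<cdot>\<^sub>m U)) = d\<^sup>2 * det (trace_form n M)"
proof -
  let ?t = "[:0, 1:] :: 'a poly"
  have "\<exists>w. (M + ?t \<cdot>\<^sub>m U) ^\<^sub>m i = pow_comb M (\<lambda>j. (if j = i then 1 else 0) + ?t * w j) n"
    if "i < n" for i
  proof -
    obtain W where "W \<in> pow_span M" and eq: "(M + ?t \<cdot>\<^sub>m U) ^\<^sub>m i = M ^\<^sub>m i + ?t \<cdot>\<^sub>m W"
      using pow_mat_perturb_in_pow_span[OF M U] by blast
    then obtain w where "W = pow_comb M w n" using M by (auto simp: pow_span_def)
    then show ?thesis
      using that by (intro exI[of _ w]) (simp only: pow_comb_add[OF M] pow_comb_unit[OF M] pow_comb_smult[OF M] eq if_True)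
  qed
  then have "\<forall>i. \<exists>w. i < n \<longrightarrow>
    (M + ?t \<cdot>\<^sub>m U) ^\<^sub>m i = pow_comb M (\<lambda>j. (if j = i then 1 else 0) + ?t * w j) n"
    by blast
  from choice[OF this] obtain w where w: "\<And>i. i < n \<Longrightarrow>
    (M + ?t \<cdot>\<^sub>m U) ^\<^sub>m i = pow_comb M (\<lambda>j. (if j = i then 1 else 0) + ?t * w i j) n"
    by blast
  let ?C = "mat n n (\<lambda>(i, j). (if j = i then 1 else 0) + ?t * w i j)"
  have "M + ?t \<cdot>\<^sub>m U \<in> carrier_mat n n" using M pow_span_carrier[OF M U] by simp
  from trace_form_basis_change[OF M this w]
  have "det (trace_form n (M + ?t \<cdot>\<^sub>m U)) = (det ?C)\<^sup>2 * det (trace_form n M)" .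
  moreover have "poly (det ?C) 0 = 1"
  proof -
    have "map_mat (\<lambda>p. poly p 0) ?C = 1\<^sub>m n" by (rule eq_matI) auto
    then show ?thesis
      using comm_ring_hom.hom_det[OF comm_ring_hom_eval_poly[of 0], of ?C] by simp
  qed
  ultimately show ?thesis by blast
qed

section \<open>Congruences for determinants and traces\<close>

text \<open>The Leibniz formula is polynomial in the entries; inside each product the factors are
  exchanged one at a time. Divisibility of differences takes the place of a quotient ring.\<close>

lemma det_cong_dvd:
  fixes X Y :: "'a :: comm_ring_1 mat"
  assumes X: "X \<in> carrier_mat n n" and Y: "Y \<in> carrier_mat n n"
    and d: "\<And>i j. i < n \<Longrightarrow> j < n \<Longrightarrow> s dvd X $$ (i, j) - Y $$ (i, j)"
  shows "s dvd det X - det Y"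
proof -
  have prod: "s dvd (\<Prod>i\<in>I. f i) - (\<Prod>i\<in>I. g i)"
    if "finite I" "\<And>i. i \<in> I \<Longrightarrow> s dvd f i - g i" for I :: "nat set" and f g :: "nat \<Rightarrow> 'a"
    using that
  proof (induction I rule: finite_induct)
    case (insert i I)
    have "f i * prod f I - g i * prod g I = (f i - g i) * prod f I + g i * (prod f I - prod g I)"
      by (simp add: algebra_simps)
    moreover have "s dvd f i - g i" "s dvd prod f I - prod g I" using insert by auto
    ultimately show ?case using insert by simp
  qed simp
  have "s dvd (\<Sum>p \<in> {p. p permutes {0..<n}}. signof p * (\<Prod>i = 0..<n. X $$ (i, p i))
      - signof p * (\<Prod>i = 0..<n. Y $$ (i, p i)))"
  proof (rule dvd_sum)
    fix p assume "p \<in> {p. p permutes {0..<n}}"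
    then have "p i < n" if "i < n" for i
      using that permutes_in_image[of p "{0..<n}" i] by simp
    then have "s dvd (\<Prod>i = 0..<n. X $$ (i, p i)) - (\<Prod>i = 0..<n. Y $$ (i, p i))"
      by (intro prod d) auto
    then show "s dvd signof p * (\<Prod>i = 0..<n. X $$ (i, p i)) - signof p * (\<Prod>i = 0..<n. Y $$ (i, p i))"
      unfolding right_diff_distrib[symmetric] by (rule dvd_mult)
  qed
  then show ?thesis using X Y by (simp add: det_def sum_subtractf)
qed

text \<open>With \<open>G\<close> invertible, \<open>L\<close> would be conjugate to
  \<open>Q\<close> modulo \<open>s\<close>. Its inverse may fail to exist over the ring, so the
  adjugate is used, at the price of the factor \<open>det G\<close>.\<close>

lemma trace_pow_intertwine:
  fixes L G Q Z :: "'a :: comm_ring_1 mat"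
  assumes car: "L \<in> carrier_mat n n" "G \<in> carrier_mat n n" "Q \<in> carrier_mat n n" "Z \<in> carrier_mat n n"
    and eq: "L * G = G * Q + s \<cdot>\<^sub>m Z"
  shows "s dvd det G * (trace_mat (L ^\<^sub>m k) - trace_mat (Q ^\<^sub>m k))"
proof -
  have p: "L ^\<^sub>m k \<in> carrier_mat n n" "Q ^\<^sub>m k \<in> carrier_mat n n" for k using car by auto
  have "\<exists>Y \<in> carrier_mat n n. L ^\<^sub>m k * G = G * Q ^\<^sub>m k + s \<cdot>\<^sub>m Y"
  proof (induction k)
    case 0
    show ?case by (rule bexI[of _ "0\<^sub>m n n"]) (use car in auto)
  next
    case (Suc k)
    then obtain Y where Y: "Y \<in> carrier_mat n n" and IH: "L ^\<^sub>m k * G = G * Q ^\<^sub>m k + s \<cdot>\<^sub>m Y" by blast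
    have "L ^\<^sub>m Suc k * G = L ^\<^sub>m k * (L * G)"
      using car p by (simp add: assoc_mult_mat[of _ n n _ n _ n])
    also have "\<dots> = L ^\<^sub>m k * G * Q + s \<cdot>\<^sub>m (L ^\<^sub>m k * Z)"
      unfolding eq using car p[of k]
      by (simp add: mult_add_distrib_mat[of _ n n _ n] assoc_mult_mat[of _ n n _ n _ n]
          mult_carrier_mat[of _ n n] mult_smult_distrib[of _ n n _ n])
    also have "L ^\<^sub>m k * G * Q = G * Q ^\<^sub>m Suc k + s \<cdot>\<^sub>m (Y * Q)"
      unfolding IH using car Y p[of k]
      by (simp add: add_mult_distrib_mat[of _ n n _ _ n] assoc_mult_mat[of _ n n _ n _ n]
          mult_carrier_mat[of _ n n] mult_smult_assoc_mat[of _ n n _ n])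
    also have "G * Q ^\<^sub>m Suc k + s \<cdot>\<^sub>m (Y * Q) + s \<cdot>\<^sub>m (L ^\<^sub>m k * Z) =
      G * Q ^\<^sub>m Suc k + s \<cdot>\<^sub>m (Y * Q + L ^\<^sub>m k * Z)"
      by (rule eq_matI) (use car Y p[of k] p[of "Suc k"] in \<open>auto simp: algebra_simps simp del: pow_mat.simps\<close>)
    finally have "L ^\<^sub>m Suc k * G = G * Q ^\<^sub>m Suc k + s \<cdot>\<^sub>m (Y * Q + L ^\<^sub>m k * Z)" .
    moreover have "Y * Q + L ^\<^sub>m k * Z \<in> carrier_mat n n" using car Y p[of k] by auto
    ultimately show ?case by blast
  qed
  then obtain Y where Y: "Y \<in> carrier_mat n n" and k: "L ^\<^sub>m k * G = G * Q ^\<^sub>m k + s \<cdot>\<^sub>m Y" by blast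
  define J where "J = adj_mat G"
  have J: "J \<in> carrier_mat n n" "G * J = det G \<cdot>\<^sub>m 1\<^sub>m n" "J * G = det G \<cdot>\<^sub>m 1\<^sub>m n"
    using adj_mat[OF car(2)] by (auto simp: J_def)
  \<comment> \<open>Insert \<open>G * J\<close>, move \<open>G\<close> past the powers at the cost
    of a multiple of \<open>s\<close>, and let cyclicity of the trace bring \<open>J\<close> and
    \<open>G\<close> together again.\<close>
  have "det G * trace_mat (L ^\<^sub>m k) = trace_mat (L ^\<^sub>m k * (G * J))"
    using p[of k] by (simp add: J(2) right_mult_one_mat[of _ n n] mult_smult_distrib[of _ n n _ n] trace_mat_smult[of _ n])
  also have "L ^\<^sub>m k * (G * J) = (G * Q ^\<^sub>m k) * J + s \<cdot>\<^sub>m (Y * J)"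
    using p[of k] car Y J(1) by (simp add: assoc_mult_mat[of _ n n _ n _ n, symmetric] k
      add_mult_distrib_mat[of _ n n _ _ n] mult_smult_assoc_mat[of _ n n _ n] mult_carrier_mat[of _ n n])
  also have "trace_mat \<dots> = trace_mat ((G * Q ^\<^sub>m k) * J) + s * trace_mat (Y * J)"
    using p[of k] car Y J(1) by (simp add: trace_mat_add[of _ n] trace_mat_smult[of _ n] mult_carrier_mat[of _ n n])
  also have "trace_mat ((G * Q ^\<^sub>m k) * J) = trace_mat (J * (G * Q ^\<^sub>m k))"
    using p[of k] car J(1) by (intro trace_mat_comm[of _ n n]) (auto simp: mult_carrier_mat[of _ n n])
  also have "J * (G * Q ^\<^sub>m k) = (J * G) * Q ^\<^sub>m k"
    using p[of k] car J(1) by (simp add: assoc_mult_mat[of _ n n _ n _ n])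
  also have "trace_mat \<dots> = det G * trace_mat (Q ^\<^sub>m k)"
    using p[of k] by (simp add: J(3) left_mult_one_mat[of _ n n] mult_smult_assoc_mat[of _ n n _ n] trace_mat_smult[of _ n])
  finally show ?thesis by (simp add: algebra_simps)
qed

text \<open>Orders of vanishing at 0 add up under multiplication, and \<open>a\<close> contributes
  none.\<close>

lemma X_power_dvd_cancel:
  fixes a b :: "'a :: field poly"
  assumes "[:0, 1:] ^ m dvd a * b" "poly a 0 \<noteq> 0"
  shows "[:0, 1:] ^ m dvd b"
proof (cases "b = 0")
  case False
  have "a \<noteq> 0" using assms(2) by auto
  with False have "m \<le> order 0 (a * b)" using assms(1) order_divides[of 0 m "a * b"] by simp
  also have "\<dots> = order 0 b"
    using False \<open>a \<noteq> 0\<close> assms(2) by (simp add: order_mult order_0I)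
  finally show ?thesis using order_divides[of 0 m b] by simp
qed simp

lemma eval_0_eq_0_imp_X_factor:
  fixes X :: "'a :: field poly mat"
  assumes "X \<in> carrier_mat n n" "map_mat (\<lambda>p. poly p 0) X = 0\<^sub>m n n"
  shows "\<exists>Z \<in> carrier_mat n n. X = [:0, 1:] \<cdot>\<^sub>m Z"
proof (rule bexI)
  have "poly (X $$ (i, j)) 0 = 0" if "i < n" "j < n" for i j
  proof -
    have "map_mat (\<lambda>p. poly p 0) X $$ (i, j) = 0" using that assms(2) by simp
    then show ?thesis using that assms(1) by simp
  qed
  then have "[:0, 1:] dvd X $$ (i, j)" if "i < n" "j < n" for i j
    using that poly_eq_0_iff_dvd[of "X $$ (i, j)" 0] by simp
  then show "X = [:0, 1:] \<cdot>\<^sub>m map_mat (\<lambda>p. p div [:0, 1:]) X"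
    using assms(1) by (intro eq_matI) (auto simp: dvd_mult_div_cancel simp del: mult_pCons_left)
qed (use assms in auto)

section \<open>Lifting along the parameter\<close>

text \<open>The bracket linear in \<open>b\<close>, \<open>g\<close>, \<open>q\<close> is the
  derivative of the intertwining relation. At t = 0, with \<open>L\<close> and \<open>Q\<close>
  equal to A, \<open>G\<close> to the identity and \<open>q\<close> a polynomial in A, it becomes
  the expression that the nSMP makes surjective.\<close>

lemma intertwine_perturb:
  fixes L G Q Z b g q :: "'a :: comm_ring_1 mat"
  assumes car: "L \<in> carrier_mat n n" "G \<in> carrier_mat n n" "Q \<in> carrier_mat n n" "Z \<in> carrier_mat n n"
      "b \<in> carrier_mat n n" "g \<in> carrier_mat n n" "q \<in> carrier_mat n n"
    and eq: "L * G = G * Q + T \<cdot>\<^sub>m Z"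
  shows "(L + T \<cdot>\<^sub>m b) * (G + T \<cdot>\<^sub>m g) = (G + T \<cdot>\<^sub>m g) * (Q + T \<cdot>\<^sub>m q)
    + T \<cdot>\<^sub>m (Z + (L * g - g * Q + b * G - G * q) + T \<cdot>\<^sub>m (b * g - g * q))"
proof -
  have expand: "(X + T \<cdot>\<^sub>m x) * (Y + T \<cdot>\<^sub>m y) = X * Y + T \<cdot>\<^sub>m (x * Y) + T \<cdot>\<^sub>m (X * y + T \<cdot>\<^sub>m (x * y))"
    if "X \<in> carrier_mat n n" "Y \<in> carrier_mat n n" "x \<in> carrier_mat n n" "y \<in> carrier_mat n n" for X Y x y
    using that by (simp add: add_mult_distrib_mat[of _ n n _ _ n] mult_add_distrib_mat[of _ n n _ n]
        mult_smult_assoc_mat[of _ n n _ n] mult_smult_distrib[of _ n n _ n])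
  show ?thesis
    unfolding expand[OF car(1,2,5,6)] expand[OF car(2,3,6,7)] eq
    by (rule eq_matI) (use car in \<open>simp_all add: algebra_simps del: index_mult_mat(1)\<close>)
qed

text \<open>Hensel lifting: when passing from \<open>t ^ Suc m\<close> to \<open>t ^ Suc (Suc m)\<close>, the correction at order
  \<open>Suc m\<close> has to solve exactly the linear equation of hypothesis \<open>surj\<close>.\<close>
lemma approximate_similarity_lift:
  fixes A :: "real mat" and M :: "real poly mat"
  assumes A: "A \<in> carrier_mat n n" and M: "M \<in> carrier_mat n n"
    and MA: "map_mat (\<lambda>p. poly p 0) M = A"
    and surj: "\<And>R. R \<in> carrier_mat n n \<Longrightarrow> \<exists>b g \<gamma>. b \<in> carrier_mat n n \<and> g \<in> carrier_mat n n \<and>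
      (\<forall>i<n. \<forall>j<n. A $$ (i, j) = 0 \<longrightarrow> b $$ (i, j) = 0) \<and> A * g - g * A + b - pow_comb A \<gamma> n = R"
  shows "\<exists>B G c Z. B \<in> carrier_mat n n \<and> G \<in> carrier_mat n n \<and> Z \<in> carrier_mat n n \<and>
    (\<forall>i<n. \<forall>j<n. A $$ (i, j) = 0 \<longrightarrow> B $$ (i, j) = 0) \<and>
    map_mat (\<lambda>p. poly p 0) B = 0\<^sub>m n n \<and> map_mat (\<lambda>p. poly p 0) G = 1\<^sub>m n \<and> (\<forall>j. poly (c j) 0 = 0) \<and>
    (map_mat (\<lambda>a. [:a:]) A + B) * G = G * (M + pow_comb M c n) + [:0, 1:] ^ Suc m \<cdot>\<^sub>m Z"
proof (induction m)
  let ?ev = "map_mat (\<lambda>p :: real poly. poly p 0)"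
  let ?A = "map_mat (\<lambda>a. [:a:]) A"
  let ?t = "[:0, 1:] :: real poly"
  have ev_hom: "semiring_hom (\<lambda>p :: real poly. poly p 0)" by unfold_locales auto
  have A': "?A \<in> carrier_mat n n" using A by simp
  have evc: "?ev (map_mat (\<lambda>a. [:a:]) X) = X" for X by (rule eq_matI) auto
  have ev_add: "?ev (X + Y) = ?ev X + ?ev Y" if "X \<in> carrier_mat n n" "Y \<in> carrier_mat n n" for X Y
    by (rule eq_matI) (use that in auto)
  have ev_diff: "?ev (X - Y) = ?ev X - ?ev Y" if "X \<in> carrier_mat n n" "Y \<in> carrier_mat n n" for X Y
    by (rule eq_matI) (use that in auto)
  have ev_smult: "?ev (s \<cdot>\<^sub>m X) = poly s 0 \<cdot>\<^sub>m ?ev X" for s X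
    by (rule eq_matI) auto
  have ev_comm: "?ev (X1 - X2 + X3 - X4) = ?ev X1 - ?ev X2 + ?ev X3 - ?ev X4"
    if "X1 \<in> carrier_mat n n" "X2 \<in> carrier_mat n n" "X3 \<in> carrier_mat n n" "X4 \<in> carrier_mat n n"
    for X1 X2 X3 X4
    by (rule eq_matI) (use that in auto)
  have ev_W: "?ev (X + Y + ?t ^ Suc m \<cdot>\<^sub>m V) = ?ev X + ?ev Y"
    if "X \<in> carrier_mat n n" "Y \<in> carrier_mat n n" "V \<in> carrier_mat n n" for X Y V m
    by (rule eq_matI) (use that in auto)
  have ev_mult: "?ev (X * Y) = ?ev X * ?ev Y" if "X \<in> carrier_mat n n" "Y \<in> carrier_mat n n" for X Y
    using semiring_hom.mat_hom_mult[OF ev_hom] that by blast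
  have ev_comb: "?ev (pow_comb M c k) = pow_comb A (\<lambda>j. poly (c j) 0) k" for c k
    using pow_comb_hom[OF comm_ring_hom_eval_poly M] MA by metis
  have comb0: "pow_comb A (\<lambda>j. 0) n = 0\<^sub>m n n" by (rule pow_comb_zero[OF A])
  {
    case 0
    \<comment> \<open>Initial data: B = 0, G = 1, c = 0. The defect A - M is divisible by t since M
      starts at A.\<close>
    have "?ev (?A - M) = 0\<^sub>m n n"
      using A by (simp add: ev_diff[OF A' M] evc MA)
    moreover have "?A - M \<in> carrier_mat n n" using A' M by auto
    ultimately obtain Z where Z: "Z \<in> carrier_mat n n" and eq: "?A - M = ?t \<cdot>\<^sub>m Z"
      using eval_0_eq_0_imp_X_factor by blast
    have c0: "pow_comb M (\<lambda>j. 0) n = 0\<^sub>m n n" by (rule pow_comb_zero[OF M])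
    have "?A $$ (i, j) = M $$ (i, j) + ?t * Z $$ (i, j)" if "i < n" "j < n" for i j
    proof -
      have "(?A - M) $$ (i, j) = (?t \<cdot>\<^sub>m Z) $$ (i, j)" by (simp only: eq)
      then show ?thesis using that A M Z by (simp add: algebra_simps)
    qed
    then have "?A = M + ?t \<cdot>\<^sub>m Z" by (intro eq_matI) (use A M Z in auto)
    then have "(?A + 0\<^sub>m n n) * 1\<^sub>m n = 1\<^sub>m n * (M + pow_comb M (\<lambda>j. 0) n) + ?t ^ Suc 0 \<cdot>\<^sub>m Z"
      using A' M by (simp add: c0 right_mult_one_mat[of _ n n] left_mult_one_mat[of _ n n] right_add_zero_mat[of _ n n])
    moreover have "?ev (0\<^sub>m n n) = 0\<^sub>m n n" "?ev (1\<^sub>m n) = 1\<^sub>m n" by (auto intro!: eq_matI)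
    ultimately show ?case using Z
      by (intro exI[of _ "0\<^sub>m n n"] exI[of _ "1\<^sub>m n"] exI[of _ "\<lambda>j. 0"] exI[of _ Z]) auto
  next
    case (Suc m)
    let ?T = "?t ^ Suc m"
    from Suc obtain B G c Z where
      car: "B \<in> carrier_mat n n" "G \<in> carrier_mat n n" "Z \<in> carrier_mat n n"
      and supp: "\<forall>i<n. \<forall>j<n. A $$ (i, j) = 0 \<longrightarrow> B $$ (i, j) = 0"
      and ev0: "?ev B = 0\<^sub>m n n" "?ev G = 1\<^sub>m n" "\<forall>j. poly (c j) 0 = 0"
      and eq: "(?A + B) * G = G * (M + pow_comb M c n) + ?T \<cdot>\<^sub>m Z"
      by blast
    \<comment> \<open>The right-hand side is minus the leading error \<open>?ev Z\<close>, so that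
      the new error vanishes at t = 0 and yields a further factor t.\<close>
    obtain b g \<gamma> where real: "b \<in> carrier_mat n n" "g \<in> carrier_mat n n"
      and bsupp: "\<forall>i<n. \<forall>j<n. A $$ (i, j) = 0 \<longrightarrow> b $$ (i, j) = 0"
      and R: "A * g - g * A + b - pow_comb A \<gamma> n = (-1) \<cdot>\<^sub>m ?ev Z"
      using surj[of "(-1) \<cdot>\<^sub>m ?ev Z"] car by auto
    let ?L = "?A + B" and ?Q = "M + pow_comb M c n"
    let ?b = "map_mat (\<lambda>a. [:a:]) b" and ?g = "map_mat (\<lambda>a. [:a:]) g" and ?q = "pow_comb M (\<lambda>j. [:\<gamma> j:]) n"
    let ?c = "\<lambda>j. c j + ?T * [:\<gamma> j:]"
    let ?W = "Z + (?L * ?g - ?g * ?Q + ?b * G - G * ?q) + ?T \<cdot>\<^sub>m (?b * ?g - ?g * ?q)"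
    have LQ: "?L \<in> carrier_mat n n" "?Q \<in> carrier_mat n n" "?b \<in> carrier_mat n n" "?g \<in> carrier_mat n n" "?q \<in> carrier_mat n n"
      using A' M car real by (auto simp: pow_comb_carrier(1)[OF M])
    note car' = LQ car mult_carrier_mat[OF LQ(1,4)] mult_carrier_mat[OF LQ(4,2)]
      mult_carrier_mat[OF LQ(3) car(2)] mult_carrier_mat[OF car(2) LQ(5)]
      mult_carrier_mat[OF LQ(3,4)] mult_carrier_mat[OF LQ(4,5)]
    have step: "(?L + ?T \<cdot>\<^sub>m ?b) * (G + ?T \<cdot>\<^sub>m ?g) = (G + ?T \<cdot>\<^sub>m ?g) * (?Q + ?T \<cdot>\<^sub>m ?q) + ?T \<cdot>\<^sub>m ?W"
      by (rule intertwine_perturb[OF LQ(1) car(2) LQ(2) car(3) LQ(3-5) eq])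
    have evL: "?ev ?L = A"
      using A A' car by (simp add: ev_add evc ev0 right_add_zero_mat[of _ n n])
    have evQ: "?ev ?Q = A"
      using A M ev0(3) by (simp add: ev_add pow_comb_carrier(1)[OF M] MA ev_comb comb0 right_add_zero_mat[of _ n n])
    have evZ: "?ev Z \<in> carrier_mat n n" using car by simp
    have comb: "pow_comb A \<gamma> n \<in> carrier_mat n n" by (rule pow_comb_carrier(1)[OF A])
    have evD: "?ev (?L * ?g - ?g * ?Q + ?b * G - G * ?q) = (-1) \<cdot>\<^sub>m ?ev Z"
    proof -
      have "?ev (?L * ?g - ?g * ?Q + ?b * G - G * ?q)
        = ?ev (?L * ?g) - ?ev (?g * ?Q) + ?ev (?b * G) - ?ev (G * ?q)"
        by (rule ev_comm[OF car'(9-12)])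
      also have "\<dots> = A * g - g * A + b - pow_comb A \<gamma> n"
        unfolding ev_mult[OF LQ(1,4)] ev_mult[OF LQ(4,2)] ev_mult[OF LQ(3) car(2)] ev_mult[OF car(2) LQ(5)]
          evL evQ evc ev0 ev_comb using real comb
        by (simp add: right_mult_one_mat[of _ n n] left_mult_one_mat[of _ n n])
      finally show ?thesis using R by simp
    qed
    \<comment> \<open>The quadratic term carries \<open>?T\<close>, a positive power of t, and
      disappears at t = 0. This is why the induction starts with precision t^1.\<close>
    have evW: "?ev ?W = 0\<^sub>m n n"
    proof -
      have "?ev ?W = ?ev Z + ?ev (?L * ?g - ?g * ?Q + ?b * G - G * ?q)"
        by (intro ev_W minus_carrier_mat add_carrier_mat car')
      then show ?thesis unfolding evD by (simp, intro eq_matI) (use car in auto)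
    qed
    have "?W \<in> carrier_mat n n"
      by (intro minus_carrier_mat add_carrier_mat smult_carrier_mat car')
    from eval_0_eq_0_imp_X_factor[OF this evW]
    obtain Z' where Z': "Z' \<in> carrier_mat n n" and W: "?W = ?t \<cdot>\<^sub>m Z'" by blast
    have Qeq: "?Q + ?T \<cdot>\<^sub>m ?q = M + pow_comb M ?c n"
      unfolding pow_comb_add[OF M] pow_comb_smult[OF M]
      by (rule assoc_add_mat[of _ n n]) (use M LQ pow_comb_carrier(1)[OF M] in auto)
    have Leq: "?L + ?T \<cdot>\<^sub>m ?b = ?A + (B + ?T \<cdot>\<^sub>m ?b)"
      by (rule assoc_add_mat[of _ n n]) (use A' car LQ in auto)
    have "?T \<cdot>\<^sub>m (?t \<cdot>\<^sub>m Z') = ?t ^ Suc (Suc m) \<cdot>\<^sub>m Z'"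
      by (rule eq_matI) (simp_all add: mult_ac)
    then have "(?A + (B + ?T \<cdot>\<^sub>m ?b)) * (G + ?T \<cdot>\<^sub>m ?g)
      = (G + ?T \<cdot>\<^sub>m ?g) * (M + pow_comb M ?c n) + ?t ^ Suc (Suc m) \<cdot>\<^sub>m Z'"
      using step unfolding W Leq Qeq by simp
    moreover have "\<forall>i<n. \<forall>j<n. A $$ (i, j) = 0 \<longrightarrow> (B + ?T \<cdot>\<^sub>m ?b) $$ (i, j) = 0"
      using supp bsupp car real by simp
    moreover have "?ev (B + ?T \<cdot>\<^sub>m ?b) = 0\<^sub>m n n"
      using car LQ real by (simp add: ev_add ev_smult ev0) (intro eq_matI; auto)
    moreover have "?ev (G + ?T \<cdot>\<^sub>m ?g) = 1\<^sub>m n"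
      using car LQ real by (simp add: ev_add ev_smult ev0) (intro eq_matI; auto)
    ultimately show ?case
      using car LQ Z' ev0(3)
      by (intro exI[of _ "B + ?T \<cdot>\<^sub>m ?b"] exI[of _ "G + ?T \<cdot>\<^sub>m ?g"] exI[of _ ?c] exI[of _ Z']) auto
  }
qed

section \<open>The nSMP as a spanning condition\<close>

text \<open>The Frobenius inner product; its positive definiteness over the reals is what turns the
  uniqueness in the nSMP into spanning.\<close>

definition inner_mat :: "nat \<Rightarrow> real mat \<Rightarrow> real mat \<Rightarrow> real" where
  "inner_mat n X Y = (\<Sum>i<n. \<Sum>j<n. X $$ (i, j) * Y $$ (i, j))"

lemma inner_mat_comm: "inner_mat n X Y = inner_mat n Y X"
  by (simp add: inner_mat_def mult.commute)

lemma inner_mat_lincomb_left: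
  assumes "X \<in> carrier_mat n n" "X' \<in> carrier_mat n n"
  shows "inner_mat n (X + c \<cdot>\<^sub>m X') Y = inner_mat n X Y + c * inner_mat n X' Y"
  using assms by (simp add: inner_mat_def algebra_simps sum.distrib sum_distrib_left)

lemma inner_mat_lincomb_right:
  assumes "X \<in> carrier_mat n n" "X' \<in> carrier_mat n n"
  shows "inner_mat n Y (X + c \<cdot>\<^sub>m X') = inner_mat n Y X + c * inner_mat n Y X'"
  using inner_mat_lincomb_left[OF assms] by (simp add: inner_mat_comm)

lemma inner_mat_self_eq_0:
  assumes "X \<in> carrier_mat n n" "inner_mat n X X = 0"
  shows "X = 0\<^sub>m n n"
proof (rule eq_matI)
  fix i j assume "i < dim_row (0\<^sub>m n n)" "j < dim_col (0\<^sub>m n n)"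
  then have ij: "i < n" "j < n" by auto
  have "(\<Sum>j<n. X $$ (i, j) * X $$ (i, j)) = 0"
    using assms(2) ij unfolding inner_mat_def
    by (subst (asm) sum_nonneg_eq_0_iff) (auto intro: sum_nonneg)
  then have "X $$ (i, j) * X $$ (i, j) = 0"
    using ij by (subst (asm) sum_nonneg_eq_0_iff) auto
  then show "X $$ (i, j) = 0\<^sub>m n n $$ (i, j)" using ij by simp
qed (use assms in auto)

text \<open>Gram-Schmidt by induction on \<open>S\<close>. The last clause is the induction
  invariant: it says, without mentioning spans, that \<open>u\<close> behaves like a combination of
  elements of \<open>S\<close>.\<close>

lemma orthogonal_decomposition:
  assumes "finite S" "S \<subseteq> V" "V \<subseteq> carrier_mat n n" "0\<^sub>m n n \<in> V"
    and V: "\<And>X Y c. X \<in> V \<Longrightarrow> Y \<in> V \<Longrightarrow> X + c \<cdot>\<^sub>m Y \<in> V"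
    and R: "R \<in> carrier_mat n n"
  shows "\<exists>u \<in> V. \<exists>x \<in> carrier_mat n n. R = u + x \<and> (\<forall>w\<in>S. inner_mat n w x = 0) \<and>
    (\<forall>y \<in> carrier_mat n n. (\<forall>w\<in>S. inner_mat n w y = 0) \<longrightarrow> inner_mat n u y = 0)"
  using assms(1,2) R
proof (induction S arbitrary: R rule: finite_induct)
  case empty
  then show ?case
    using assms(4) by (intro bexI[of _ "0\<^sub>m n n"] bexI[of _ R]) (auto simp: inner_mat_def)
next
  case (insert s S)
  have s: "s \<in> V" "s \<in> carrier_mat n n" and S: "S \<subseteq> V" using insert assms(3) by auto
  obtain u1 x1 where 1: "u1 \<in> V" "x1 \<in> carrier_mat n n" "s = u1 + x1" "\<forall>w\<in>S. inner_mat n w x1 = 0"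
    "\<And>y. y \<in> carrier_mat n n \<Longrightarrow> \<forall>w\<in>S. inner_mat n w y = 0 \<Longrightarrow> inner_mat n u1 y = 0"
    using insert.IH[OF S s(2)] by blast
  obtain u2 x2 where 2: "u2 \<in> V" "x2 \<in> carrier_mat n n" "R = u2 + x2" "\<forall>w\<in>S. inner_mat n w x2 = 0"
    "\<And>y. y \<in> carrier_mat n n \<Longrightarrow> \<forall>w\<in>S. inner_mat n w y = 0 \<Longrightarrow> inner_mat n u2 y = 0"
    using insert.IH[OF S insert.prems(2)] by blast
  have u: "u1 \<in> carrier_mat n n" "u2 \<in> carrier_mat n n" using 1(1) 2(1) assms(3) by auto
  have car: "w \<in> carrier_mat n n" if "w \<in> S" for w using that S assms(3) by auto
  have x1: "x1 = s + (-1) \<cdot>\<^sub>m u1"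
    by (rule eq_matI) (use 1(2) u in \<open>auto simp: 1(3)\<close>)
  then have x1V: "x1 \<in> V" using V[OF s(1) 1(1)] by simp
  \<comment> \<open>Coefficient of the projection of \<open>x2\<close> onto \<open>x1\<close>, the
    part of \<open>s\<close> orthogonal to \<open>S\<close>. If \<open>x1\<close> is zero, division
    by zero gives 0, which is harmless.\<close>
  define a where "a = inner_mat n x1 x2 / inner_mat n x1 x1"
  define x where "x = x2 + (-a) \<cdot>\<^sub>m x1"
  have x: "x \<in> carrier_mat n n" using 1(2) 2(2) by (simp add: x_def)
  have xS: "\<forall>w\<in>S. inner_mat n w x = 0"
    using 1(2,4) 2(2,4) by (simp add: x_def inner_mat_lincomb_right)
  have "inner_mat n x1 x = 0"
  proof (cases "inner_mat n x1 x1 = 0")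
    case True
    then have "x1 = 0\<^sub>m n n" using inner_mat_self_eq_0 1(2) by blast
    then show ?thesis by (simp add: inner_mat_def)
  next
    case False
    then show ?thesis using 1(2) 2(2) by (simp add: x_def inner_mat_lincomb_right a_def)
  qed
  moreover have "s = u1 + 1 \<cdot>\<^sub>m x1" unfolding 1(3) by (rule eq_matI) (use 1(2) u in auto)
  ultimately have "inner_mat n s x = 0"
    using inner_mat_lincomb_left[OF u(1) 1(2), of 1 x] 1(5)[OF x xS] by simp
  moreover have "R = (u2 + a \<cdot>\<^sub>m x1) + x"
    unfolding 2(3) x_def by (rule eq_matI) (use 1(2) 2(2) u in auto)
  moreover have "inner_mat n (u2 + a \<cdot>\<^sub>m x1) y = 0"
    if y: "y \<in> carrier_mat n n" "\<forall>w\<in>insert s S. inner_mat n w y = 0" for y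
  proof -
    have "inner_mat n x1 y = 0"
      unfolding x1 using inner_mat_lincomb_left[OF s(2) u(1), of "-1" y] 1(5)[OF y(1)] y(2) by simp
    then show ?thesis
      using inner_mat_lincomb_left[OF u(2) 1(2), of a y] 2(5)[OF y(1)] y(2) by simp
  qed
  ultimately show ?case
    using V[OF 2(1) x1V, of a] x xS by (intro bexI[of _ "u2 + a \<cdot>\<^sub>m x1"] bexI[of _ x]) auto
qed

definition mat_unit :: "nat \<Rightarrow> nat \<Rightarrow> nat \<Rightarrow> real mat" where
  "mat_unit n k l = mat n n (\<lambda>(i, j). if i = k \<and> j = l then 1 else 0)"

lemma mat_unit_carrier [simp]: "mat_unit n k l \<in> carrier_mat n n"
  "dim_row (mat_unit n k l) = n" "dim_col (mat_unit n k l) = n"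
  by (simp_all add: mat_unit_def)

lemma inner_mat_unit:
  assumes "k < n" "l < n"
  shows "inner_mat n (mat_unit n k l) X = X $$ (k, l)"
proof -
  have "inner_mat n (mat_unit n k l) X = (\<Sum>i<n. \<Sum>j<n. if i = k then if j = l then X $$ (i, j) else 0 else 0)"
    unfolding inner_mat_def mat_unit_def by (intro sum.cong) auto
  also have "\<dots> = (\<Sum>i<n. if i = k then X $$ (i, l) else 0)"
    using assms by (intro sum.cong) auto
  finally show ?thesis using assms by simp
qed

lemma inner_mat_trace:
  assumes "X \<in> carrier_mat n n" "Y \<in> carrier_mat n n"
  shows "inner_mat n X Y = trace_mat (transpose_mat Y * X)"
proof -
  have "trace_mat (transpose_mat Y * X) = (\<Sum>j<n. \<Sum>i<n. X $$ (i, j) * Y $$ (i, j))"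
    using assms by (auto simp: trace_mat_def scalar_prod_def atLeast0LessThan mult.commute intro!: sum.cong)
  then show ?thesis unfolding inner_mat_def by (subst sum.swap) simp
qed

text \<open>By cyclicity, tr(X^T (A E - E A)) = tr((X^T A - A X^T) E). For the unit matrix E at (k,
  l) this trace picks out the entry with the indices exchanged.\<close>

lemma inner_mat_commutator_unit:
  assumes A: "A \<in> carrier_mat n n" and X: "X \<in> carrier_mat n n" and kl: "k < n" "l < n"
  shows "inner_mat n (A * mat_unit n k l - mat_unit n k l * A) X
    = (transpose_mat X * A - A * transpose_mat X) $$ (l, k)"
proof -
  have AE: "(A * mat_unit n k l) $$ (i, j) = (if j = l then A $$ (i, k) else 0)" if "i < n" "j < n" for i j
  proof -
    have "(A * mat_unit n k l) $$ (i, j) = (\<Sum>m<n. A $$ (i, m) * mat_unit n k l $$ (m, j))"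
      using A that by (simp add: scalar_prod_def atLeast0LessThan mat_unit_def)
    also have "\<dots> = (\<Sum>m<n. if m = k then if j = l then A $$ (i, m) else 0 else 0)"
      using that by (intro sum.cong) (auto simp: mat_unit_def)
    finally show ?thesis using kl by simp
  qed
  have EA: "(mat_unit n k l * A) $$ (i, j) = (if i = k then A $$ (l, j) else 0)" if "i < n" "j < n" for i j
  proof -
    have "(mat_unit n k l * A) $$ (i, j) = (\<Sum>m<n. mat_unit n k l $$ (i, m) * A $$ (m, j))"
      using A that by (simp add: scalar_prod_def atLeast0LessThan mat_unit_def)
    also have "\<dots> = (\<Sum>m<n. if m = l then if i = k then A $$ (m, j) else 0 else 0)"
      using that by (intro sum.cong) (auto simp: mat_unit_def)
    finally show ?thesis using kl by simp
  qed
  have "inner_mat n (A * mat_unit n k l - mat_unit n k l * A) X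
    = (\<Sum>i<n. \<Sum>j<n. (if j = l then A $$ (i, k) * X $$ (i, j) else 0)
        - (if i = k then A $$ (l, j) * X $$ (i, j) else 0))"
    unfolding inner_mat_def
    using A by (intro sum.cong) (auto simp: AE EA algebra_simps simp del: index_mult_mat(1))
  also have "\<dots> = (\<Sum>i<n. \<Sum>j<n. if j = l then A $$ (i, k) * X $$ (i, j) else 0)
    - (\<Sum>j<n. \<Sum>i<n. if i = k then A $$ (l, j) * X $$ (i, j) else 0)"
    unfolding sum_subtractf by (subst (2) sum.swap) simp
  also have "\<dots> = (\<Sum>i<n. A $$ (i, k) * X $$ (i, l)) - (\<Sum>j<n. A $$ (l, j) * X $$ (k, j))"
    using kl by simp
  also have "\<dots> = (transpose_mat X * A - A * transpose_mat X) $$ (l, k)"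
    using A X kl by (simp add: scalar_prod_def atLeast0LessThan mult.commute)
  finally show ?thesis .
qed

text \<open>Split \<open>R\<close> into a part in the space \<open>V\<close> of attainable matrices
  and a part \<open>x\<close> orthogonal to its generators. Orthogonality to the three kinds of
  generators is exactly the three conditions of the nSMP, so \<open>x\<close> vanishes.\<close>

lemma nSMP_spanning:
  assumes nSMP: "nSMP n A" and R: "R \<in> carrier_mat n n"
  shows "\<exists>b g \<gamma>. b \<in> carrier_mat n n \<and> g \<in> carrier_mat n n \<and>
      (\<forall>i<n. \<forall>j<n. A $$ (i, j) = 0 \<longrightarrow> b $$ (i, j) = 0) \<and> A * g - g * A + b - pow_comb A \<gamma> n = R"
proof -
  have A: "A \<in> carrier_mat n n" using nSMP by (simp add: nSMP_def)
  define good where "good b g \<longleftrightarrow> b \<in> carrier_mat n n \<and> g \<in> carrier_mat n n \<and>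
      (\<forall>i<n. \<forall>j<n. A $$ (i, j) = 0 \<longrightarrow> b $$ (i, j) = 0)" for b g :: "real mat"
  define F where "F b g \<gamma> = A * g - g * A + b - pow_comb A \<gamma> n" for b g \<gamma>
  define V where "V = {F b g \<gamma> |b g \<gamma>. good b g}"
  have VI: "F b g \<gamma> \<in> V" if "good b g" for b g \<gamma> using that by (auto simp: V_def)
  \<comment> \<open>A finite list of generators, one group for each condition: commutators with unit
    matrices, unit matrices on the support, powers.\<close>
  define S where "S = (\<lambda>(k, l). A * mat_unit n k l - mat_unit n k l * A) ` ({..<n} \<times> {..<n})
    \<union> (\<lambda>(k, l). mat_unit n k l) ` {(k, l) \<in> {..<n} \<times> {..<n}. A $$ (k, l) \<noteq> 0}
    \<union> (\<lambda>j. A ^\<^sub>m j) ` {..<n}"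
  have comb: "pow_comb A \<gamma> n \<in> carrier_mat n n" for \<gamma> by (rule pow_comb_carrier(1)[OF A])
  have g0: "A * 0\<^sub>m n n - 0\<^sub>m n n * A = 0\<^sub>m n n" using A by (intro eq_matI) auto
  have "S \<subseteq> V"
  proof
    fix w assume "w \<in> S"
    then consider (comm) k l where "k < n" "l < n" "w = A * mat_unit n k l - mat_unit n k l * A"
      | (unit) k l where "k < n" "l < n" "A $$ (k, l) \<noteq> 0" "w = mat_unit n k l"
      | (pow) j where "j < n" "w = A ^\<^sub>m j"
      unfolding S_def by auto
    then show "w \<in> V"
    proof cases
      case comm
      have "w = F (0\<^sub>m n n) (mat_unit n k l) (\<lambda>j. 0)"
        unfolding comm F_def pow_comb_zero[OF A] using A by (intro eq_matI) auto
      then show ?thesis using VI[of "0\<^sub>m n n" "mat_unit n k l"] by (auto simp: good_def)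
    next
      case unit
      have "w = F (mat_unit n k l) (0\<^sub>m n n) (\<lambda>j. 0)"
        unfolding unit F_def pow_comb_zero[OF A] g0 by (intro eq_matI) (auto simp: mat_unit_def)
      moreover have "good (mat_unit n k l) (0\<^sub>m n n)"
        using unit by (auto simp: good_def mat_unit_def)
      ultimately show ?thesis using VI by metis
    next
      case pow
      \<comment> \<open>The factor -1 compensates for \<open>F\<close> subtracting the polynomial in
        \<open>A\<close>.\<close>
      have "w = F (0\<^sub>m n n) (0\<^sub>m n n) (\<lambda>i. (-1) * (if i = j then 1 else 0))"
        unfolding pow F_def pow_comb_smult[OF A] pow_comb_unit[OF A] g0
        using pow A by (intro eq_matI) (auto simp: square_pow_mat_dims[OF A] simp del: pow_mat_dim)
      then show ?thesis using VI[of "0\<^sub>m n n" "0\<^sub>m n n"] by (auto simp: good_def)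
    qed
  qed
  moreover have "finite S"
  proof -
    have "finite {(k, l) \<in> {..<n} \<times> {..<n}. A $$ (k, l) \<noteq> 0}"
      by (rule finite_subset[of _ "{..<n} \<times> {..<n}"]) auto
    then show ?thesis unfolding S_def by simp
  qed
  moreover have "V \<subseteq> carrier_mat n n"
    using A comb by (auto simp: V_def F_def good_def)
  moreover have "0\<^sub>m n n \<in> V"
  proof -
    have "0\<^sub>m n n = F (0\<^sub>m n n) (0\<^sub>m n n) (\<lambda>j. 0)"
      unfolding F_def pow_comb_zero[OF A] g0 by (intro eq_matI) auto
    moreover have "good (0\<^sub>m n n) (0\<^sub>m n n)" by (simp add: good_def)
    ultimately show ?thesis using VI by metis
  qed
  moreover have "X + c \<cdot>\<^sub>m Y \<in> V" if XY: "X \<in> V" "Y \<in> V" for X Y c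
  proof -
    obtain b g \<gamma> b' g' \<gamma>' where 1: "X = F b g \<gamma>" "good b g" and 2: "Y = F b' g' \<gamma>'" "good b' g'"
      using XY by (auto simp: V_def)
    have car: "b \<in> carrier_mat n n" "g \<in> carrier_mat n n" "b' \<in> carrier_mat n n" "g' \<in> carrier_mat n n"
      using 1 2 by (auto simp: good_def)
    have Ag: "A * (g + c \<cdot>\<^sub>m g') = A * g + c \<cdot>\<^sub>m (A * g')" "(g + c \<cdot>\<^sub>m g') * A = g * A + c \<cdot>\<^sub>m (g' * A)"
      using A car by (simp_all add: add_mult_distrib_mat[of _ n n _ _ n] mult_add_distrib_mat[of _ n n _ n]
        mult_smult_assoc_mat[of _ n n _ n] mult_smult_distrib[of _ n n _ n])
    have "X + c \<cdot>\<^sub>m Y = F (b + c \<cdot>\<^sub>m b') (g + c \<cdot>\<^sub>m g') (\<lambda>j. \<gamma> j + c * \<gamma>' j)"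
      unfolding 1 2 F_def pow_comb_add[OF A] pow_comb_smult[OF A] Ag
      by (rule eq_matI) (use A car comb pow_comb_carrier[OF A] in \<open>auto simp: algebra_simps simp del: index_mult_mat(1)\<close>)
    moreover have "good (b + c \<cdot>\<^sub>m b') (g + c \<cdot>\<^sub>m g')" using 1 2 by (auto simp: good_def)
    ultimately show ?thesis using VI by metis
  qed
  ultimately obtain u x where u: "u \<in> V" and x: "x \<in> carrier_mat n n" and Rux: "R = u + x"
    and orth: "\<forall>w\<in>S. inner_mat n w x = 0"
    using orthogonal_decomposition[of S V n R] R by blast
  have "hadamard_mat A x = 0\<^sub>m n n"
  proof (rule eq_matI)
    fix i j assume "i < dim_row (0\<^sub>m n n)" "j < dim_col (0\<^sub>m n n)"
    then have ij: "i < n" "j < n" by auto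
    have "x $$ (i, j) = 0" if "A $$ (i, j) \<noteq> 0"
    proof -
      have "mat_unit n i j \<in> S" using ij that by (force simp: S_def)
      then show ?thesis using orth inner_mat_unit[OF ij, of x] by simp
    qed
    then show "hadamard_mat A x $$ (i, j) = 0\<^sub>m n n $$ (i, j)"
      using ij A by (auto simp: hadamard_mat_def)
  qed (use A in \<open>auto simp: hadamard_mat_def\<close>)
  moreover have "A * transpose_mat x - transpose_mat x * A = 0\<^sub>m n n"
  proof (rule eq_matI)
    fix l k assume "l < dim_row (0\<^sub>m n n)" "k < dim_col (0\<^sub>m n n)"
    then have kl: "k < n" "l < n" by auto
    then have "A * mat_unit n k l - mat_unit n k l * A \<in> S" by (force simp: S_def)
    then have "(transpose_mat x * A - A * transpose_mat x) $$ (l, k) = 0"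
      using orth inner_mat_commutator_unit[OF A x kl] by simp
    then show "(A * transpose_mat x - transpose_mat x * A) $$ (l, k) = 0\<^sub>m n n $$ (l, k)"
      using kl A x by (simp del: index_mult_mat(1))
  qed (use A x in auto)
  moreover have "trace_mat (transpose_mat x * A ^\<^sub>m k) = 0" if "k < n" for k
  proof -
    have "A ^\<^sub>m k \<in> S" using that by (auto simp: S_def)
    then show ?thesis using orth inner_mat_trace[OF pow_carrier_mat[OF A] x, of k] by simp
  qed
  ultimately have "x = 0\<^sub>m n n" using nSMP x by (auto simp: nSMP_def)
  then have "R \<in> V" using Rux u \<open>V \<subseteq> carrier_mat n n\<close> by (auto simp: right_add_zero_mat[of _ n n])
  then show ?thesis unfolding V_def F_def good_def by blast
qed

section \<open>Trace form and eigenvalues\<close>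

text \<open>Combine the relations with the coefficients of the Lagrange polynomial \<open>q\<close>,
  which vanishes at every node except \<open>l i\<close>. Its degree is n - 1, so the exponents
  below \<open>n\<close> suffice.\<close>

lemma vandermonde_kernel:
  fixes l m :: "nat \<Rightarrow> 'a :: field"
  assumes inj: "inj_on l {..<n}" and eq: "\<And>k. k < n \<Longrightarrow> (\<Sum>i<n. m i * l i ^ k) = 0" and i: "i < n"
  shows "m i = 0"
proof -
  define q where "q = (\<Prod>j\<in>{..<n} - {i}. [:- l j, 1:])"
  have "degree q = card ({..<n} - {i})"
    unfolding q_def by (subst degree_prod_eq_sum_degree) auto
  then have deg: "degree q < n" using i by simp
  have q: "poly q x = (\<Prod>j\<in>{..<n} - {i}. x - l j)" for x
    by (simp add: q_def poly_prod)
  have "0 = (\<Sum>k\<le>degree q. coeff q k * (\<Sum>a<n. m a * l a ^ k))"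
    using eq deg by (intro sum.neutral[symmetric]) auto
  also have "\<dots> = (\<Sum>a<n. m a * poly q (l a))"
    unfolding poly_altdef sum_distrib_left by (subst sum.swap) (simp add: mult_ac)
  also have "\<dots> = (\<Sum>a<n. if a = i then m i * poly q (l i) else 0)"
    by (intro sum.cong refl) (auto simp: q)
  also have "\<dots> = m i * poly q (l i)" using i by simp
  finally have "m i * poly q (l i) = 0" by simp
  moreover have "poly q (l i) \<noteq> 0"
    using inj i by (auto simp: q inj_on_def)
  ultimately show ?thesis by simp
qed

lemma upper_triangular_mult_diag:
  fixes U V :: "'a :: comm_ring_1 mat"
  assumes car: "U \<in> carrier_mat n n" "V \<in> carrier_mat n n"
    and "upper_triangular U" "upper_triangular V"
  shows "upper_triangular (U * V)" and "i < n \<Longrightarrow> (U * V) $$ (i, i) = U $$ (i, i) * V $$ (i, i)"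
proof -
  have UV: "U $$ (i, k) * V $$ (k, j) = 0" if "i < n" "j < n" "k < n" "k < i \<or> j < k" for i j k
    using that assms by (auto simp: upper_triangular_def)
  show "upper_triangular (U * V)"
    unfolding upper_triangular_def
  proof (intro allI impI)
    fix i j assume "i < dim_row (U * V)" "j < i"
    then have ij: "i < n" "j < i" using car by auto
    have "(U * V) $$ (i, j) = (\<Sum>k<n. U $$ (i, k) * V $$ (k, j))"
      using ij car by (simp add: scalar_prod_def atLeast0LessThan)
    also have "\<dots> = 0"
      by (rule sum.neutral) (use UV ij in \<open>metis lessThan_iff less_trans linorder_neqE_nat\<close>)
    finally show "(U * V) $$ (i, j) = 0" .
  qed
  assume i: "i < n"
  have "(U * V) $$ (i, i) = (\<Sum>k<n. U $$ (i, k) * V $$ (k, i))"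
    using i car by (simp add: scalar_prod_def atLeast0LessThan)
  also have "\<dots> = (\<Sum>k<n. if k = i then U $$ (i, i) * V $$ (i, i) else 0)"
    by (rule sum.cong) (use UV i in \<open>auto simp: neq_iff\<close>)
  finally show "(U * V) $$ (i, i) = U $$ (i, i) * V $$ (i, i)" using i by simp
qed

lemma upper_triangular_pow_diag:
  fixes U :: "'a :: comm_ring_1 mat"
  assumes U: "U \<in> carrier_mat n n" "upper_triangular U"
  shows "upper_triangular (U ^\<^sub>m k) \<and> (\<forall>i<n. (U ^\<^sub>m k) $$ (i, i) = U $$ (i, i) ^ k)"
proof (induction k)
  case 0
  then show ?case using U by auto
next
  case (Suc k)
  then show ?case
    using upper_triangular_mult_diag[OF pow_carrier_mat[OF U(1)] U(1) _ U(2), of k]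
    by (simp add: mult.commute)
qed

lemma det_trace_form_upper_triangular:
  fixes U :: "'a :: field mat"
  assumes U: "U \<in> carrier_mat n n" "upper_triangular U"
  shows "det (trace_form n U) \<noteq> 0 \<longleftrightarrow> inj_on (\<lambda>i. U $$ (i, i)) {..<n}"
proof -
  let ?l = "\<lambda>i. U $$ (i, i)"
  let ?V = "mat n n (\<lambda>(k, i). ?l i ^ k)"
  have "trace_form n U = ?V * transpose_mat ?V"
  proof (rule eq_matI)
    fix i j assume "i < dim_row (?V * transpose_mat ?V)" "j < dim_col (?V * transpose_mat ?V)"
    then have ij: "i < n" "j < n" by auto
    have "trace_form n U $$ (i, j) = (\<Sum>a<n. (U ^\<^sub>m (i + j)) $$ (a, a))"
      using ij U square_pow_mat_dims(3)[OF U(1)] by (simp add: trace_form_def trace_mat_def)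
    also have "\<dots> = (\<Sum>a<n. ?l a ^ i * ?l a ^ j)"
      using upper_triangular_pow_diag[OF U] by (simp add: power_add)
    also have "\<dots> = (?V * transpose_mat ?V) $$ (i, j)"
      using ij by (simp add: scalar_prod_def atLeast0LessThan)
    finally show "trace_form n U $$ (i, j) = (?V * transpose_mat ?V) $$ (i, j)" .
  qed auto
  then have "det (trace_form n U) = det ?V * det ?V"
    by (simp add: det_mult[of _ n] det_transpose[of _ n])
  moreover have "det ?V = 0 \<longleftrightarrow> \<not> inj_on ?l {..<n}"
  proof
    assume "\<not> inj_on ?l {..<n}"
    then obtain a b where ab: "a < n" "b < n" "a \<noteq> b" "?l a = ?l b" by (auto simp: inj_on_def)
    have "col ?V a = col ?V b" using ab by (intro eq_vecI) auto
    then show "det ?V = 0" using ab det_identical_columns[of ?V n a b] by simp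
  next
    \<comment> \<open>A kernel vector of \<open>?V\<close> supplies the weights excluded by
      \<open>vandermonde_kernel\<close>.\<close>
    assume "det ?V = 0"
    then obtain v where v: "v \<in> carrier_vec n" "v \<noteq> 0\<^sub>v n" "?V *\<^sub>v v = 0\<^sub>v n"
      using det_0_iff_vec_prod_zero_field[of ?V n] by auto
    have "(\<Sum>i<n. v $ i * ?l i ^ k) = 0" if k: "k < n" for k
    proof -
      have "(?V *\<^sub>v v) $ k = 0" using v(3) k by simp
      then show ?thesis
        using k v(1) by (simp add: scalar_prod_def atLeast0LessThan mult.commute)
    qed
    moreover have "\<exists>i<n. v $ i \<noteq> 0"
    proof (rule ccontr)
      assume "\<not> (\<exists>i<n. v $ i \<noteq> 0)"
      then have "v = 0\<^sub>v n" using v(1) by (intro eq_vecI) auto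
      then show False using v(2) by simp
    qed
    ultimately show "\<not> inj_on ?l {..<n}"
      using vandermonde_kernel[of ?l n "\<lambda>i. v $ i"] by blast
  qed
  ultimately show ?thesis by auto
qed

lemma trace_form_similar:
  fixes A :: "'a :: comm_ring_1 mat"
  assumes "A \<in> carrier_mat n n" "similar_mat A B"
  shows "trace_form n A = trace_form n B"
proof -
  obtain P Q where w: "similar_mat_wit A B P Q" using assms(2) by (auto simp: similar_mat_def)
  show ?thesis
    by (rule eq_matI) (auto simp: trace_form_def intro!: trace_mat_similar[OF similar_mat_wit_pow[OF w]])
qed

text \<open>A Schur form keeps traces of powers and spectrum; on it the determinant tests whether
  the diagonal entries, which are the eigenvalues, are pairwise different.\<close>

lemma det_trace_form_nonzero_imp_card_spectrum:
  fixes A :: "complex mat"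
  assumes A: "A \<in> carrier_mat n n" and det: "det (trace_form n A) \<noteq> 0"
  shows "card (spectrum A) = n"
proof -
  obtain es where "char_poly A = (\<Prod>a\<leftarrow>es. [:- a, 1:])" using char_poly_factorized[OF A] by blast
  from schur_decomposition_exists[OF A this]
  obtain B where B: "B \<in> carrier_mat n n" "upper_triangular B" "similar_mat A B" by blast
  have "char_poly A = (\<Prod>a\<leftarrow>diag_mat B. [:- a, 1:])"
    using char_poly_similar[OF B(3)] char_poly_upper_triangular[OF B(1,2)] by simp
  then have "spectrum A = set (diag_mat B)"
    by (auto simp: spectrum_root_char_poly[OF A] poly_prod_list prod_list_zero_iff)
  also have "\<dots> = (\<lambda>i. B $$ (i, i)) ` {..<n}"
    using B(1) by (auto simp: diag_mat_def atLeast0LessThan)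
  finally have "spectrum A = (\<lambda>i. B $$ (i, i)) ` {..<n}" .
  moreover have "inj_on (\<lambda>i. B $$ (i, i)) {..<n}"
    using det det_trace_form_upper_triangular[OF B(1,2)] trace_form_similar[OF A B(3)] by simp
  ultimately show ?thesis by (simp add: card_image)
qed

lemma det_trace_form_nonzero_imp_distinct_eigenvalues:
  assumes A: "A \<in> carrier_mat n n" and "det (trace_form n A) \<noteq> 0"
  shows "distinct_eigenvalues n A"
proof -
  have h: "comm_ring_hom complex_of_real" by unfold_locales auto
  have "det (trace_form n (map_mat complex_of_real A)) = complex_of_real (det (trace_form n A))"
    by (simp add: trace_form_hom[OF h A, symmetric] comm_ring_hom.hom_det[OF h])
  then have "det (trace_form n (map_mat complex_of_real A)) \<noteq> 0" using assms(2) by simp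
  then show ?thesis
    using A det_trace_form_nonzero_imp_card_spectrum[of "map_mat complex_of_real A" n]
    by (simp add: distinct_eigenvalues_def)
qed

section \<open>Diagonalization and the implication from distinct eigenvalues to the nSMP\<close>

lemma distinct_spectrum_diagonalizable:
  fixes A :: "'a :: field mat"
  assumes A: "A \<in> carrier_mat n n" and card: "card (spectrum A) = n"
  shows "\<exists>l P Q. inj_on l {..<n} \<and> similar_mat_wit A (mat n n (\<lambda>(i, j). if i = j then l i else 0)) P Q"
proof -
  obtain l where l: "bij_betw l {..<n} (spectrum A)"
    using ex_bij_betw_nat_finite[OF card_finite_spectrum(1)[OF A]] card by (auto simp: atLeast0LessThan)
  have inj: "inj_on l {..<n}" using l by (rule bij_betw_imp_inj_on)
  have "\<exists>v. eigenvector A v (l i)" if "i < n" for i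
    using l that unfolding bij_betw_def spectrum_def eigenvalue_def by auto
  then obtain v where v: "\<And>i. i < n \<Longrightarrow> eigenvector A (v i) (l i)" by metis
  have vn: "v i \<in> carrier_vec n" "v i \<noteq> 0\<^sub>v n" if "i < n" for i
    using v[OF that] A by (auto simp: eigenvector_def)
  have Av: "(\<Sum>s<n. A $$ (r, s) * v i $ s) = l i * v i $ r" if "i < n" "r < n" for i r
  proof -
    have "(A *\<^sub>v v i) $ r = (l i \<cdot>\<^sub>v v i) $ r" using v[OF that(1)] by (simp add: eigenvector_def)
    then show ?thesis using that vn(1)[OF that(1)] A by (simp add: scalar_prod_def atLeast0LessThan)
  qed
  let ?D = "mat n n (\<lambda>(i, j). if i = j then l i else 0)"
  define P where "P = mat n n (\<lambda>(r, i). v i $ r)"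
  have P: "P \<in> carrier_mat n n" by (simp add: P_def)
  have AP: "A * P = P * ?D"
  proof (rule eq_matI)
    fix r i assume "r < dim_row (P * ?D)" "i < dim_col (P * ?D)"
    then have ri: "r < n" "i < n" using P by auto
    have "(P * ?D) $$ (r, i) = (\<Sum>s<n. P $$ (r, s) * ?D $$ (s, i))"
      using ri P by (simp add: scalar_prod_def atLeast0LessThan)
    also have "\<dots> = (\<Sum>s<n. if s = i then v i $ r * l i else 0)"
      using ri by (intro sum.cong) (auto simp: P_def)
    also have "\<dots> = (A * P) $$ (r, i)"
      using ri A Av[OF ri(2,1)] by (simp add: P_def scalar_prod_def atLeast0LessThan mult.commute)
    finally show "(A * P) $$ (r, i) = (P * ?D) $$ (r, i)" by simp
  qed (use A P in auto)
  have "det P \<noteq> 0"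
  proof
    assume "det P = 0"
    then obtain w where w: "w \<in> carrier_vec n" "w \<noteq> 0\<^sub>v n" "P *\<^sub>v w = 0\<^sub>v n"
      using det_0_iff_vec_prod_zero_field[OF P] by auto
    \<comment> \<open>Applying \<open>A\<close> repeatedly to a linear relation among the
      eigenvectors weights it with powers of the eigenvalues; each coordinate then gives a
      Vandermonde system.\<close>
    have "(\<Sum>i<n. (w $ i * v i $ r) * l i ^ k) = 0" if "r < n" for k r
      using that
    proof (induction k arbitrary: r)
      case 0
      have "(P *\<^sub>v w) $ r = 0" using w(3) 0 by simp
      then show ?case using 0 w(1) by (simp add: P_def scalar_prod_def atLeast0LessThan mult.commute)
    next
      case (Suc k)
      have "(\<Sum>i<n. (w $ i * v i $ r) * l i ^ Suc k) = (\<Sum>i<n. w $ i * l i ^ k * (\<Sum>s<n. A $$ (r, s) * v i $ s))"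
        using Suc(2) by (intro sum.cong) (auto simp: Av)
      also have "\<dots> = (\<Sum>s<n. A $$ (r, s) * (\<Sum>i<n. (w $ i * v i $ s) * l i ^ k))"
        unfolding sum_distrib_left by (subst sum.swap) (simp add: mult_ac)
      also have "\<dots> = 0" using Suc.IH by simp
      finally show ?case .
    qed
    then have "w $ i * v i $ r = 0" if "i < n" "r < n" for i r
      using vandermonde_kernel[OF inj, of "\<lambda>i. w $ i * v i $ r"] that by blast
    moreover have "\<exists>r<n. v i $ r \<noteq> 0" if "i < n" for i
    proof (rule ccontr)
      assume "\<not> (\<exists>r<n. v i $ r \<noteq> 0)"
      then have "v i = 0\<^sub>v n" using vn(1)[OF that] by (intro eq_vecI) auto
      then show False using vn(2)[OF that] by simp
    qed
    ultimately have "w $ i = 0" if "i < n" for i using that by (metis mult_eq_0_iff)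
    then have "w = 0\<^sub>v n" using w(1) by (intro eq_vecI) auto
    then show False using w(2) by simp
  qed
  then obtain Q where Q: "Q \<in> carrier_mat n n" "Q * P = 1\<^sub>m n" "P * Q = 1\<^sub>m n"
    using det_non_zero_imp_unit[OF P, of "()"] by (auto simp: Units_def ring_mat_def)
  have "A = P * ?D * Q"
  proof -
    have "A = A * (P * Q)" using A by (simp add: Q(3))
    also have "\<dots> = A * P * Q" using A P Q by (simp add: assoc_mult_mat[of _ n n _ n _ n])
    finally show ?thesis unfolding AP .
  qed
  then have "similar_mat_wit A ?D P Q" using A P Q by (intro similar_mat_witI[of _ _ n]) auto
  then show ?thesis using inj by blast
qed

lemma distinct_spectrum_commuting_trace_zero:
  fixes A Y :: "'a :: field mat"
  assumes A: "A \<in> carrier_mat n n" and card: "card (spectrum A) = n"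
    and Y: "Y \<in> carrier_mat n n" and comm: "A * Y = Y * A"
    and tr: "\<And>k. k < n \<Longrightarrow> trace_mat (Y * A ^\<^sub>m k) = 0"
  shows "Y = 0\<^sub>m n n"
proof -
  obtain l P Q where inj: "inj_on l {..<n}"
    and wit: "similar_mat_wit A (mat n n (\<lambda>(i, j). if i = j then l i else 0)) P Q"
    using distinct_spectrum_diagonalizable[OF A card] by blast
  define D where "D = mat n n (\<lambda>(i, j). if i = j then l i else 0)"
  have D: "D \<in> carrier_mat n n" by (simp add: D_def)
  note w = similar_mat_witD2(1,2,3,6,7)[OF A wit[folded D_def]]
  define W where "W = Q * Y * P"
  have W: "W \<in> carrier_mat n n" using w Y by (auto simp: W_def)
  note assoc = assoc_mult_mat[of _ n n _ n _ n]
  note cl = mult_carrier_mat[of _ n n _ n]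
  have QP: "Q * (P * X) = X" "P * (Q * X) = X" if "X \<in> carrier_mat n n" for X
  proof -
    have "Q * (P * X) = Q * P * X" "P * (Q * X) = P * Q * X"
      using w(4,5) that by (simp_all add: assoc)
    then show "Q * (P * X) = X" "P * (Q * X) = X" using that w(1,2) by simp_all
  qed
  have YW: "Y = P * W * Q"
    unfolding W_def using w Y by (simp add: assoc cl QP)
  have DQ: "Q * A = D * Q" "A * P = P * D"
    unfolding w(3) using w D by (simp_all add: assoc cl QP)
  have "D * W = Q * (A * Y) * P"
  proof -
    have "D * W = D * Q * Y * P" unfolding W_def using w D Y by (simp add: assoc cl)
    also have "\<dots> = Q * (A * Y) * P" unfolding DQ(1)[symmetric] using w(4,5) A Y by (simp add: assoc cl)
    finally show ?thesis .
  qed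
  also have "\<dots> = Q * Y * (A * P)" unfolding comm using w(4,5) A Y by (simp add: assoc cl)
  also have "\<dots> = W * D" unfolding DQ(2) W_def using w(4,5) D Y by (simp add: assoc cl)
  finally have DW: "D * W = W * D" .
  \<comment> \<open>Comparing entries of D W = W D gives (l_i - l_j) W_ij = 0.\<close>
  have diag: "W $$ (i, j) = 0" if ij: "i < n" "j < n" "i \<noteq> j" for i j
  proof -
    have "(D * W) $$ (i, j) = (\<Sum>s<n. D $$ (i, s) * W $$ (s, j))"
      using ij D W by (simp add: scalar_prod_def atLeast0LessThan)
    also have "\<dots> = (\<Sum>s<n. if s = i then l i * W $$ (i, j) else 0)"
      using ij by (intro sum.cong) (auto simp: D_def)
    finally have 1: "(D * W) $$ (i, j) = l i * W $$ (i, j)" using ij by simp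
    have "(W * D) $$ (i, j) = (\<Sum>s<n. W $$ (i, s) * D $$ (s, j))"
      using ij D W by (simp add: scalar_prod_def atLeast0LessThan)
    also have "\<dots> = (\<Sum>s<n. if s = j then W $$ (i, j) * l j else 0)"
      using ij by (intro sum.cong) (auto simp: D_def)
    finally have "(W * D) $$ (i, j) = W $$ (i, j) * l j" using ij by simp
    with 1 DW have "(l i - l j) * W $$ (i, j) = 0" by (auto simp: algebra_simps)
    moreover have "l i \<noteq> l j" using inj ij by (auto simp: inj_on_def)
    ultimately show ?thesis by simp
  qed
  have up: "upper_triangular D" "upper_triangular W" using D W diag by (auto simp: upper_triangular_def D_def)
  \<comment> \<open>\<open>Y * A ^\<^sub>m k\<close> is similar to \<open>W * D ^\<^sub>m k\<close>,
    whose diagonal is read off from that of the triangular factors.\<close>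
  have "(\<Sum>i<n. W $$ (i, i) * l i ^ k) = 0" if "k < n" for k
  proof -
    have Dk: "D ^\<^sub>m k \<in> carrier_mat n n" using D by simp
    have "Y * A ^\<^sub>m k = P * (W * D ^\<^sub>m k) * Q"
      unfolding similar_mat_wit_pow_id[OF wit[folded D_def]] YW using w(4,5) W Dk
      by (simp add: assoc cl QP)
    moreover have "Y * A ^\<^sub>m k \<in> carrier_mat n n" using Y A by (auto intro: cl)
    ultimately have "similar_mat_wit (Y * A ^\<^sub>m k) (W * D ^\<^sub>m k) P Q"
      using w W Dk by (intro similar_mat_witI[of _ _ n]) (auto intro: cl)
    then have "0 = trace_mat (W * D ^\<^sub>m k)" using trace_mat_similar tr[OF that] by metis
    also have "\<dots> = (\<Sum>i<n. (W * D ^\<^sub>m k) $$ (i, i))" using W by (simp add: trace_mat_def)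
    also have "\<dots> = (\<Sum>i<n. W $$ (i, i) * l i ^ k)"
      using upper_triangular_pow_diag[OF D up(1), of k] upper_triangular_mult_diag(2)[OF W Dk up(2)]
      by (intro sum.cong) (auto simp: D_def)
    finally show ?thesis by simp
  qed
  then have "W $$ (i, i) = 0" if "i < n" for i
    using vandermonde_kernel[OF inj, of "\<lambda>i. W $$ (i, i)"] that by blast
  then have "W $$ (i, j) = 0" if "i < n" "j < n" for i j
    using diag that by (cases "i = j") auto
  then have "W = 0\<^sub>m n n" using W by (intro eq_matI) auto
  then show ?thesis unfolding YW using w by simp
qed

text \<open>Eigenvalues of a real matrix may be non-real, so the hypotheses are transported to
  complex matrices and the vanishing is brought back entry by entry.\<close>

lemma distinct_eigenvalues_imp_nSMP:
  assumes "distinct_eigenvalues n A"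
  shows "nSMP n A"
  unfolding nSMP_def
proof (intro conjI ballI impI)
  let ?c = "map_mat complex_of_real"
  have h: "comm_ring_hom complex_of_real" and sh: "semiring_hom complex_of_real" by (unfold_locales; auto)+
  show A: "A \<in> carrier_mat n n" using assms by (simp add: distinct_eigenvalues_def)
  fix X assume X: "X \<in> carrier_mat n n"
    and comm: "A * transpose_mat X - transpose_mat X * A = 0\<^sub>m n n"
    and tr: "\<forall>k<n. trace_mat (transpose_mat X * A ^\<^sub>m k) = 0"
  let ?Y = "transpose_mat X"
  have Y: "?Y \<in> carrier_mat n n" using X by simp
  have AY: "A * ?Y = ?Y * A"
  proof (rule eq_matI)
    fix i j assume "i < dim_row (?Y * A)" "j < dim_col (?Y * A)"
    then have ij: "i < n" "j < n" using A X by auto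
    have "(A * ?Y - ?Y * A) $$ (i, j) = 0" using comm ij by simp
    then show "(A * ?Y) $$ (i, j) = (?Y * A) $$ (i, j)" using ij A X by (simp del: index_mult_mat(1))
  qed (use A X in auto)
  have "?c ?Y = 0\<^sub>m n n"
  proof (rule distinct_spectrum_commuting_trace_zero)
    show "?c A \<in> carrier_mat n n" "?c ?Y \<in> carrier_mat n n" using A Y by auto
    show "card (spectrum (?c A)) = n" using assms by (simp add: distinct_eigenvalues_def)
    show "?c A * ?c ?Y = ?c ?Y * ?c A"
      using semiring_hom.mat_hom_mult[OF sh A Y] semiring_hom.mat_hom_mult[OF sh Y A] AY by simp
    fix k assume "k < n"
    have Ak: "A ^\<^sub>m k \<in> carrier_mat n n" using A by simp
    have "?c ?Y * ?c A ^\<^sub>m k = ?c (?Y * A ^\<^sub>m k)"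
      using semiring_hom.mat_hom_mult[OF sh Y Ak] semiring_hom.mat_hom_pow[OF sh A] by simp
    then show "trace_mat (?c ?Y * ?c A ^\<^sub>m k) = 0"
      using trace_mat_hom[OF h mult_carrier_mat[OF Y Ak]] tr \<open>k < n\<close> by simp
  qed
  then have "?c ?Y $$ (j, i) = 0" if "i < n" "j < n" for i j using that by simp
  then show "X = 0\<^sub>m n n" using X by (intro eq_matI) auto
qed

section \<open>Sign patterns\<close>

text \<open>The support condition keeps the zeros of \<open>A\<close> for all t, and the vanishing
  of \<open>B\<close> at 0 keeps the nonzero signs for small t.\<close>

lemma nSMP_imp_polynomial_family:
  assumes nSMP: "nSMP n A"
  shows "\<exists>B :: real poly mat. B \<in> carrier_mat n n \<and> (\<forall>i<n. \<forall>j<n. A $$ (i, j) = 0 \<longrightarrow> B $$ (i, j) = 0) \<and>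
    map_mat (\<lambda>p. poly p 0) B = 0\<^sub>m n n \<and> det (trace_form n (map_mat (\<lambda>a. [:a:]) A + B)) \<noteq> 0"
proof -
  have A: "A \<in> carrier_mat n n" using nSMP by (simp add: nSMP_def)
  \<comment> \<open>Any real matrix with \<open>n\<close> distinct eigenvalues could end the path;
    this one makes them visible on the diagonal.\<close>
  define D where "D = mat n n (\<lambda>(i, j). if i = j then real i else 0)"
  \<comment> \<open>the line \<open>(1 - t) A + t D\<close>\<close>
  define M where "M = mat n n (\<lambda>(i, j). [:A $$ (i, j), D $$ (i, j) - A $$ (i, j):])"
  have M: "M \<in> carrier_mat n n" by (simp add: M_def)
  have M0: "map_mat (\<lambda>p. poly p 0) M = A" and M1: "map_mat (\<lambda>p. poly p 1) M = D"
    using A by (auto simp: M_def D_def)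
  have "upper_triangular D" by (auto simp: upper_triangular_def D_def)
  then have "det (trace_form n D) \<noteq> 0"
    by (subst det_trace_form_upper_triangular) (auto simp: D_def inj_on_def)
  also have "det (trace_form n D) = poly (det (trace_form n M)) 1"
    by (simp add: M1[symmetric] trace_form_hom[OF comm_ring_hom_eval_poly M, symmetric]
        comm_ring_hom.hom_det[OF comm_ring_hom_eval_poly])
  finally have detM: "det (trace_form n M) \<noteq> 0" by auto
  \<comment> \<open>Chosen so that t^(m+1) cannot divide the nonzero discriminant of
    \<open>M\<close>.\<close>
  define m where "m = degree (det (trace_form n M))"
  let ?t = "[:0, 1:] :: real poly" and ?A = "map_mat (\<lambda>a. [:a:]) A"
  obtain B G c Z where car: "B \<in> carrier_mat n n" "G \<in> carrier_mat n n" "Z \<in> carrier_mat n n"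
    and supp: "\<forall>i<n. \<forall>j<n. A $$ (i, j) = 0 \<longrightarrow> B $$ (i, j) = 0"
    and B0: "map_mat (\<lambda>p. poly p 0) B = 0\<^sub>m n n" and G0: "map_mat (\<lambda>p. poly p 0) G = 1\<^sub>m n"
    and c0: "\<forall>j. poly (c j) 0 = 0"
    and eq: "(?A + B) * G = G * (M + pow_comb M c n) + ?t ^ Suc m \<cdot>\<^sub>m Z"
    using approximate_similarity_lift[OF A M M0 nSMP_spanning[OF nSMP], where m = m] by blast
  define Q where "Q = M + pow_comb M c n"
  define L where "L = ?A + B"
  have L: "L \<in> carrier_mat n n" and Q: "Q \<in> carrier_mat n n"
    using A car M by (auto simp: L_def Q_def pow_comb_carrier(1)[OF M])
  \<comment> \<open>A common factor t comes out of all coefficients, bringing \<open>Q\<close> into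
    the form M + tU required by \<open>det_trace_form_perturb\<close>.\<close>
  have "?t dvd c j" for j using c0 poly_eq_0_iff_dvd[of "c j" 0] by simp
  then have "c = (\<lambda>j. ?t * (c j div ?t))"
    by (intro ext) (metis dvd_mult_div_cancel)
  then have "Q = M + ?t \<cdot>\<^sub>m pow_comb M (\<lambda>j. c j div ?t) n"
    unfolding Q_def by (metis pow_comb_smult[OF M])
  moreover have "pow_comb M (\<lambda>j. c j div ?t) n \<in> pow_span M"
    using M by (auto simp: pow_span_def)
  ultimately obtain d where d0: "poly d 0 = 1" and detQ: "det (trace_form n Q) = d\<^sup>2 * det (trace_form n M)"
    using det_trace_form_perturb[OF M] by metis
  \<comment> \<open>Hence the factor \<open>det G\<close> left by
    \<open>trace_pow_intertwine\<close> cancels against powers of t.\<close>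
  have "poly (det G) 0 = 1"
    using comm_ring_hom.hom_det[OF comm_ring_hom_eval_poly[of 0], of G] by (simp add: G0)
  then have "?t ^ Suc m dvd trace_mat (L ^\<^sub>m k) - trace_mat (Q ^\<^sub>m k)" for k
    using X_power_dvd_cancel[OF trace_pow_intertwine[OF L car(2) Q car(3) eq[folded L_def Q_def]]] by simp
  then have dvd: "?t ^ Suc m dvd det (trace_form n L) - det (trace_form n Q)"
    by (intro det_cong_dvd) (auto simp: trace_form_def)
  have "det (trace_form n L) \<noteq> 0"
  proof
    assume "det (trace_form n L) = 0"
    then have "?t ^ Suc m dvd d\<^sup>2 * det (trace_form n M)" using dvd detQ by simp
    then have "?t ^ Suc m dvd det (trace_form n M)"
      by (rule X_power_dvd_cancel) (simp add: d0)
    then have "degree (?t ^ Suc m) \<le> m" unfolding m_def by (rule dvd_imp_degree_le[OF _ detM])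
    then show False by (simp add: degree_power_eq del: power_Suc)
  qed
  then show ?thesis using car supp B0 by (auto simp: L_def)
qed

theorem theorem4p1:
  fixes n :: nat and P :: "pattern_entry mat"
  assumes "P \<in> carrier_mat n n"
  shows "pattern_allows P (nSMP n) \<longleftrightarrow> pattern_allows P (distinct_eigenvalues n)"
proof
  assume "pattern_allows P (distinct_eigenvalues n)"
  then show "pattern_allows P (nSMP n)"
    using distinct_eigenvalues_imp_nSMP by (auto simp: pattern_allows_def)
next
  assume "pattern_allows P (nSMP n)"
  then obtain A where AP: "A \<in> qualitative_class P" and nSMP: "nSMP n A"
    by (auto simp: pattern_allows_def)
  have A: "A \<in> carrier_mat n n" using nSMP by (simp add: nSMP_def)
  obtain B :: "real poly mat" where B: "B \<in> carrier_mat n n"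
    and supp: "\<And>i j. i < n \<Longrightarrow> j < n \<Longrightarrow> A $$ (i, j) = 0 \<Longrightarrow> B $$ (i, j) = 0"
    and B0: "map_mat (\<lambda>p. poly p 0) B = 0\<^sub>m n n"
    and det: "det (trace_form n (map_mat (\<lambda>a. [:a:]) A + B)) \<noteq> 0"
    using nSMP_imp_polynomial_family[OF nSMP] by blast
  define L where "L = map_mat (\<lambda>a. [:a:]) A + B"
  have L: "L \<in> carrier_mat n n" using A B by (simp add: L_def)
  have Lij: "poly (L $$ (i, j)) x = A $$ (i, j) + poly (B $$ (i, j)) x" if "i < n" "j < n" for i j x
    using that A B by (simp add: L_def)
  have sign: "eventually (\<lambda>x. has_sign (poly (L $$ (i, j)) x) (P $$ (i, j))) (at_right 0)"
    if ij: "i < n" "j < n" for i j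
  proof -
    have s: "has_sign (A $$ (i, j)) (P $$ (i, j))"
      using AP assms ij by (auto simp: qualitative_class_def)
    have "map_mat (\<lambda>p. poly p 0) B $$ (i, j) = 0" using B0 ij by simp
    then have L0: "poly (L $$ (i, j)) 0 = A $$ (i, j)" using ij B by (simp add: Lij)
    have lim: "(poly (L $$ (i, j)) \<longlongrightarrow> A $$ (i, j)) (at_right 0)"
      unfolding L0[symmetric] by (intro tendsto_intros)
    show ?thesis
    proof (cases "P $$ (i, j)")
      case PosEntry
      then show ?thesis using order_tendstoD(1)[OF lim, of 0] s by simp
    next
      case NegEntry
      then show ?thesis using order_tendstoD(2)[OF lim, of 0] s by simp
    next
      \<comment> \<open>Continuity cannot preserve an exact zero; here \<open>B\<close> vanishes
        identically in t.\<close>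
      case ZeroEntry
      then have "A $$ (i, j) = 0" using s by simp
      then show ?thesis using ij supp ZeroEntry by (simp add: Lij)
    qed
  qed
  have "eventually (\<lambda>x. \<forall>ij \<in> {..<n} \<times> {..<n}. has_sign (poly (L $$ ij) x) (P $$ ij)) (at_right 0)"
    by (rule eventually_ball_finite) (use sign in auto)
  \<comment> \<open>A nonzero polynomial has finitely many roots, and each is avoided close to 0,
    the point 0 itself being excluded by the one-sided filter.\<close>
  moreover have "eventually (\<lambda>x. poly (det (trace_form n L)) x \<noteq> 0) (at_right 0)"
  proof -
    have "finite {x. poly (det (trace_form n L)) x = 0}"
      using det by (intro poly_roots_finite) (simp add: L_def)
    then have "eventually (\<lambda>x. \<forall>r \<in> {x. poly (det (trace_form n L)) x = 0}. x \<noteq> r) (at_right 0)"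
      by (rule eventually_ball_finite) (auto intro: eventually_neq_at_within)
    then show ?thesis by (rule eventually_mono) auto
  qed
  ultimately have "eventually (\<lambda>x. (\<forall>ij \<in> {..<n} \<times> {..<n}. has_sign (poly (L $$ ij) x) (P $$ ij)) \<and>
      poly (det (trace_form n L)) x \<noteq> 0) (at_right (0::real))"
    by (rule eventually_conj)
  then have "\<exists>x. (\<forall>ij \<in> {..<n} \<times> {..<n}. has_sign (poly (L $$ ij) x) (P $$ ij)) \<and>
      poly (det (trace_form n L)) x \<noteq> 0"
    by (rule eventually_happens'[rotated]) simp
  then obtain x where sgn: "\<forall>ij \<in> {..<n} \<times> {..<n}. has_sign (poly (L $$ ij) x) (P $$ ij)"
    and nz: "poly (det (trace_form n L)) x \<noteq> 0"
    by blast
  let ?L = "map_mat (\<lambda>p. poly p x) L"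
  have "?L \<in> qualitative_class P"
    using sgn L assms by (auto simp: qualitative_class_def)
  moreover have "det (trace_form n ?L) \<noteq> 0"
    using nz by (simp add: trace_form_hom[OF comm_ring_hom_eval_poly L, symmetric]
        comm_ring_hom.hom_det[OF comm_ring_hom_eval_poly])
  then have "distinct_eigenvalues n ?L"
    by (rule det_trace_form_nonzero_imp_distinct_eigenvalues[rotated]) (use L in simp)
  ultimately show "pattern_allows P (distinct_eigenvalues n)"
    by (auto simp: pattern_allows_def)
qed

end
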